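(* Let $\Omega\subset\mathbb{R}^d$ be a bounded domain and let $J$ satisfy: (a) $J:L^2(\Omega)\to\mathbb{R}$ is bounded from below; (b) $J:L^1(\Omega)\to\mathbb{R}$ is Fréchet differentiable. Let $(U^n)_n\subset\mathcal{B}$, $(D^n)_n\subset\mathcal{B}$ and $(\Delta^n)_n\subset(0,\Delta_{\max}]$ be the sequences of sets and trust-region radii produced by the binary trust-region steepest descent (BTR) algorithm described in the context. Then the sequence of objective values $(J(\chi_{U^n}))_n$ is monotonically nonincreasing. Moreover, one of the following mutually exclusive outcomes holds: 1. There exists $n_0\in\mathbb{N}$ such that $U^{n_0}=U^n$ (up to null sets) for all $n\ge n_0$. Then $\chi_{U^{n_0}}$ is stationary for (R). 2. For all $n_0\in\mathbb{N}$ there exists $n_1>n_0$ such that $\lambda(U^{n_1}\triangle U^{n_0})>0$. The sequence $(\chi_{U^n})_n\subset L^\infty(\Omega)$ admits a weak-$^*$ accumulation point, and every weak-$^*$ accumulation point of $(\chi_{U^n})_n$ is feasible for (R). If additionally $\nabla J:L^1(\Omega)\to L^2(\Omega)$ is Lipschitz continuous, then $\lim_{n\to\infty}C(\chi_{U^n})=0$. If additionally $\nabla J:L^2(\Omega)\to L^2(\Omega)$ is weak-norm continuous (completely continuous) and if a subsequence $(\chi_{U^{n_k}})_k$ of $(\chi_{U^n})_n$ satisfies $C(\chi_{U^{n_k}})\to 0$, then every weak-$^*$ accumulation point $f$ of $(\chi_{U^{n_k}})_k$ satisfies $C(f)=0$, i.e., $f$ is stationary for (R).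
   Context: $\Omega\subset\mathbb{R}^d$ is a bounded domain, $\lambda$ is Lebesgue measure, $\mathcal{B}$ the Borel $\sigma$-algebra on $\Omega$, $A^c=\Omega\setminus A$, $\triangle$ the symmetric difference, $\chi_A$ the $\{0,1\}$-valued characteristic function of $A$. The derivative of $J:L^1(\Omega)\to\mathbb{R}$ at $x$ is represented by $\nabla J(x)\in L^\infty(\Omega)\subset L^2(\Omega)$; on $L^2(\Omega)\subset L^1(\Omega)$, $J$ is the restriction. Weak-norm continuous means: $x^n\rightharpoonup x$ in $L^2(\Omega)$ implies $\nabla J(x^n)\to\nabla J(x)$ in $L^2(\Omega)$. Weak-$^*$ accumulation points are taken in $L^\infty(\Omega)$. Relaxed problem (R): minimize $J(x)$ over $x\in L^2(\Omega)$ with $x(s)\in[0,1]$ for a.a. $s\in\Omega$; such $x$ are called feasible for (R). Criticality measure: for $x\in L^2(\Omega)$, $C(x):=\max\{\int_\Omega\nabla J(x)(x-f)\,\mathrm{d}s : f \text{ feasible for (R)}\}=\int_\Omega\nabla J(x)x\,\mathrm{d}s+\int_\Omega\max\{-\nabla J(x),0\}\,\mathrm{d}s$. A feasible $x$ for (R) is called stationary if $C(x)=0$. BTR algorithm. Inputs: $J$, $\nabla J$, $\Delta_{\max}\in(0,\lambda(\Omega))$, $0<\sigma_1<\sigma_2\le1$, $\omega\in(0,1)$, $U^0\in\mathcal{B}$, $\Delta^0\in(0,\Delta_{\max})$. For $n=0,1,2,\dots$: - Set $g^n:=\nabla J(\chi_{U^n})(\chi_{(U^n)^c}-\chi_{U^n})$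 (pointwise product). - Set $D^n:=\mathtt{FindStep}(g^n,\Delta^n,\delta^n)$ with $\delta^n:=\min\{\omega,\ \tfrac12\|\min\{g^n,0\}\|_{L^1}/\lambda(\Omega),\ \Delta^n\}$. Here $\mathtt{FindStep}(g,\Delta,\delta)$ is any procedure returning a set $D\in\mathcal{B}$ with $D\subset g^{-1}((-\infty,0])$, $\lambda(D)\le\Delta$ and $\int_D g\,\mathrm{d}s\le\min\{\int_{D'}g\,\mathrm{d}s : D'\in\mathcal{B},\ D'\subset g^{-1}((-\infty,0]),\ \lambda(D')\le\Delta\}+\delta\Delta$. - Let $p^n:=(\nabla J(\chi_{U^n}),\chi_{D^n\setminus U^n}-\chi_{U^n\cap D^n})_{L^2}$. If $J(\chi_{U^n\triangle D^n})-J(\chi_{U^n})\le\sigma_1p^n$ (step accepted), set $U^{n+1}:=U^n\triangle D^n$, and set $\Delta^{n+1}:=\min\{2\Delta^n,\Delta_{\max}\}$ if moreover $J(\chi_{U^n\triangle D^n})-J(\chi_{U^n})\le\sigma_2p^n$, and $\Delta^{n+1}:=\Delta^n$ otherwise. If the step is not accepted, set $U^{n+1}:=U^n$, $\Delta^{n+1}:=\tfrac12\Delta^n$. *)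

theory Defs
  imports "HOL-Analysis.Analysis"
begin

(* Elements of Lebesgue spaces are represented by measurable functions; functions that agree
   almost everywhere represent the same element.  The definitions below only depend on a.e. classes
   as long as J does (see well_defined_on_L1), except that the sets of the algorithm are honest
   Borel sets. *)

(* Lebesgue measure on the Borel sigma-algebra of \<Omega>. *)
abbreviation lborel_on :: "'a::euclidean_space set \<Rightarrow> 'a measure" where
  "lborel_on \<Omega> \<equiv> restrict_space lborel \<Omega>"

definition L1 :: "'a measure \<Rightarrow> ('a \<Rightarrow> real) set" where
  "L1 M = {f. integrable M f}"

definition L2 :: "'a measure \<Rightarrow> ('a \<Rightarrow> real) set" where
  "L2 M = {f \<in> borel_measurable M. integrable M (\<lambda>s. (f s)\<^sup>2)}"

definition Linf :: "'a measure \<Rightarrow> ('a \<Rightarrow> real) set" where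
  "Linf M = {f \<in> borel_measurable M. \<exists>K. AE s in M. \<bar>f s\<bar> \<le> K}"

definition L1_norm :: "'a measure \<Rightarrow> ('a \<Rightarrow> real) \<Rightarrow> real" where
  "L1_norm M f = (LINT s|M. \<bar>f s\<bar>)"

definition L2_norm :: "'a measure \<Rightarrow> ('a \<Rightarrow> real) \<Rightarrow> real" where
  "L2_norm M f = sqrt (LINT s|M. (f s)\<^sup>2)"

definition L2_weakly_converges ::
  "'a measure \<Rightarrow> (nat \<Rightarrow> 'a \<Rightarrow> real) \<Rightarrow> ('a \<Rightarrow> real) \<Rightarrow> bool" where
  "L2_weakly_converges M X x \<longleftrightarrow> (\<forall>n. X n \<in> L2 M) \<and> x \<in> L2 M \<and>
     (\<forall>\<phi>\<in>L2 M. (\<lambda>n. LINT s|M. X n s * \<phi> s) \<longlonglongrightarrow> (LINT s|M. x s * \<phi> s))"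

(* The initial topology on Linf induced by the functionals "integrate against \<phi>", for \<phi> in L1. *)
definition weak_star_topology :: "'a measure \<Rightarrow> ('a \<Rightarrow> real) topology" where
  "weak_star_topology M =
     pullback_topology (Linf M) (\<lambda>f. \<lambda>\<phi>\<in>L1 M. LINT s|M. f s * \<phi> s)
       (product_topology (\<lambda>_. euclideanreal) (L1 M))"

definition weak_star_accumulation_point ::
  "'a measure \<Rightarrow> (nat \<Rightarrow> 'a \<Rightarrow> real) \<Rightarrow> ('a \<Rightarrow> real) \<Rightarrow> bool" where
  "weak_star_accumulation_point M X f \<longleftrightarrow> f \<in> Linf M \<and>
     (\<forall>V. openin (weak_star_topology M) V \<and> f \<in> V \<longrightarrow> (\<exists>\<^sub>F n in sequentially. X n \<in> V))"


(* J, given on representatives, descends to a functional on the space L1. *)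
definition well_defined_on_L1 :: "'a measure \<Rightarrow> (('a \<Rightarrow> real) \<Rightarrow> real) \<Rightarrow> bool" where
  "well_defined_on_L1 M J \<longleftrightarrow>
     (\<forall>x\<in>L1 M. \<forall>y\<in>L1 M. (AE s in M. x s = y s) \<longrightarrow> J x = J y)"

definition bounded_below_on_L2 :: "'a measure \<Rightarrow> (('a \<Rightarrow> real) \<Rightarrow> real) \<Rightarrow> bool" where
  "bounded_below_on_L2 M J \<longleftrightarrow> (\<exists>b. \<forall>x\<in>L2 M. b \<le> J x)"

definition bounded_linear_on_L1 :: "'a measure \<Rightarrow> (('a \<Rightarrow> real) \<Rightarrow> real) \<Rightarrow> bool" where
  "bounded_linear_on_L1 M A \<longleftrightarrow>
     (\<forall>x\<in>L1 M. \<forall>y\<in>L1 M. A (\<lambda>s. x s + y s) = A x + A y) \<and>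
     (\<forall>c. \<forall>x\<in>L1 M. A (\<lambda>s. c * x s) = c * A x) \<and>
     (\<exists>K. \<forall>x\<in>L1 M. \<bar>A x\<bar> \<le> K * L1_norm M x)"

definition has_L1_frechet_derivative ::
  "'a measure \<Rightarrow> (('a \<Rightarrow> real) \<Rightarrow> real) \<Rightarrow> (('a \<Rightarrow> real) \<Rightarrow> real) \<Rightarrow> ('a \<Rightarrow> real) \<Rightarrow> bool" where
  "has_L1_frechet_derivative M J A x \<longleftrightarrow> bounded_linear_on_L1 M A \<and>
     (\<forall>\<epsilon>>0. \<exists>\<eta>>0. \<forall>h\<in>L1 M. L1_norm M h < \<eta> \<longrightarrow>
        \<bar>J (\<lambda>s. x s + h s) - J x - A h\<bar> \<le> \<epsilon> * L1_norm M h)"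

definition L1_frechet_differentiable :: "'a measure \<Rightarrow> (('a \<Rightarrow> real) \<Rightarrow> real) \<Rightarrow> bool" where
  "L1_frechet_differentiable M J \<longleftrightarrow> (\<forall>x\<in>L1 M. \<exists>A. has_L1_frechet_derivative M J A x)"

(* G x is a representative in Linf of the derivative of J at x. *)
definition represents_derivative ::
  "'a measure \<Rightarrow> (('a \<Rightarrow> real) \<Rightarrow> real) \<Rightarrow> (('a \<Rightarrow> real) \<Rightarrow> 'a \<Rightarrow> real) \<Rightarrow> bool" where
  "represents_derivative M J G \<longleftrightarrow>
     (\<forall>x\<in>L1 M. G x \<in> Linf M \<and>
        (\<forall>A. has_L1_frechet_derivative M J A x \<longrightarrow> (\<forall>h\<in>L1 M. A h = (LINT s|M. G x s * h s))))"

definition lipschitz_L1_L2 :: "'a measure \<Rightarrow> (('a \<Rightarrow> real) \<Rightarrow> 'a \<Rightarrow> real) \<Rightarrow> bool" where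
  "lipschitz_L1_L2 M G \<longleftrightarrow>
     (\<exists>L. \<forall>x\<in>L1 M. \<forall>y\<in>L1 M.
        L2_norm M (\<lambda>s. G x s - G y s) \<le> L * L1_norm M (\<lambda>s. x s - y s))"

definition weak_norm_continuous_L2 :: "'a measure \<Rightarrow> (('a \<Rightarrow> real) \<Rightarrow> 'a \<Rightarrow> real) \<Rightarrow> bool" where
  "weak_norm_continuous_L2 M G \<longleftrightarrow>
     (\<forall>X x. L2_weakly_converges M X x \<longrightarrow> (\<lambda>n. L2_norm M (\<lambda>s. G (X n) s - G x s)) \<longlonglongrightarrow> 0)"


definition feasible :: "'a measure \<Rightarrow> ('a \<Rightarrow> real) set" where
  "feasible M = {x \<in> L2 M. AE s in M. 0 \<le> x s \<and> x s \<le> 1}"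

(* The supremum is a maximum in the setting of interest, see criticality_is_max. *)
definition criticality ::
  "'a measure \<Rightarrow> (('a \<Rightarrow> real) \<Rightarrow> 'a \<Rightarrow> real) \<Rightarrow> ('a \<Rightarrow> real) \<Rightarrow> real" where
  "criticality M G x = (SUP f\<in>feasible M. LINT s|M. G x s * (x s - f s))"

definition stationary ::
  "'a measure \<Rightarrow> (('a \<Rightarrow> real) \<Rightarrow> 'a \<Rightarrow> real) \<Rightarrow> ('a \<Rightarrow> real) \<Rightarrow> bool" where
  "stationary M G x \<longleftrightarrow> x \<in> feasible M \<and> criticality M G x = 0"


(* Since g is only determined up to null sets, the inclusion of D in the sublevel set of g at 0 is
   required up to null sets. *)
definition step_candidates :: "'a measure \<Rightarrow> ('a \<Rightarrow> real) \<Rightarrow> real \<Rightarrow> 'a set set" where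
  "step_candidates M g \<Delta> = {D \<in> sets M. (AE s in M. s \<in> D \<longrightarrow> g s \<le> 0) \<and> measure M D \<le> \<Delta>}"

(* D is an admissible output of FindStep(g, \<Delta>, \<delta>).  As the measure is nonatomic, the infimum is
   attained, so that it is the minimum over all candidate sets. *)
definition find_step ::
  "'a measure \<Rightarrow> ('a \<Rightarrow> real) \<Rightarrow> real \<Rightarrow> real \<Rightarrow> 'a set \<Rightarrow> bool" where
  "find_step M g \<Delta> \<delta> D \<longleftrightarrow> D \<in> step_candidates M g \<Delta> \<and>
     (LINT s:D|M. g s) \<le> (INF D'\<in>step_candidates M g \<Delta>. LINT s:D'|M. g s) + \<delta> * \<Delta>"

definition signed_gradient ::
  "'a measure \<Rightarrow> (('a \<Rightarrow> real) \<Rightarrow> 'a \<Rightarrow> real) \<Rightarrow> 'a set \<Rightarrow> 'a \<Rightarrow> real" where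
  "signed_gradient M G U s =
     G (indicator U) s * (indicator (space M - U) s - indicator U s)"

definition step_tolerance ::
  "'a measure \<Rightarrow> ('a \<Rightarrow> real) \<Rightarrow> real \<Rightarrow> real \<Rightarrow> real" where
  "step_tolerance M g \<omega> \<Delta> =
     Min {\<omega>, 1/2 * L1_norm M (\<lambda>s. min (g s) 0) / measure M (space M), \<Delta>}"

definition predicted_change ::
  "'a measure \<Rightarrow> (('a \<Rightarrow> real) \<Rightarrow> 'a \<Rightarrow> real) \<Rightarrow> 'a set \<Rightarrow> 'a set \<Rightarrow> real" where
  "predicted_change M G U D =
     (LINT s|M. G (indicator U) s * (indicator (D - U) s - indicator (U \<inter> D) s))"

definition actual_change ::
  "(('a \<Rightarrow> real) \<Rightarrow> real) \<Rightarrow> 'a set \<Rightarrow> 'a set \<Rightarrow> real" where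
  "actual_change J U D = J (indicator (sym_diff U D)) - J (indicator U)"

(* U, D, \<Delta> are sequences that the algorithm can produce; D n and \<Delta> n are the step and the radius used
   in iteration n. *)
definition BTR_run ::
  "'a measure \<Rightarrow> (('a \<Rightarrow> real) \<Rightarrow> real) \<Rightarrow> (('a \<Rightarrow> real) \<Rightarrow> 'a \<Rightarrow> real) \<Rightarrow>
   real \<Rightarrow> real \<Rightarrow> real \<Rightarrow> real \<Rightarrow>
   (nat \<Rightarrow> 'a set) \<Rightarrow> (nat \<Rightarrow> 'a set) \<Rightarrow> (nat \<Rightarrow> real) \<Rightarrow> bool" where
  "BTR_run M J G \<Delta>max \<sigma>1 \<sigma>2 \<omega> U D \<Delta> \<longleftrightarrow>
     U 0 \<in> sets M \<and> 0 < \<Delta> 0 \<and> \<Delta> 0 < \<Delta>max \<and>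
     (\<forall>n.
        let g = signed_gradient M G (U n);
            p = predicted_change M G (U n) (D n);
            a = actual_change J (U n) (D n)
        in find_step M g (\<Delta> n) (step_tolerance M g \<omega> (\<Delta> n)) (D n) \<and>
           (if a \<le> \<sigma>1 * p
            then U (Suc n) = sym_diff (U n) (D n) \<and>
                 \<Delta> (Suc n) = (if a \<le> \<sigma>2 * p then min (2 * \<Delta> n) \<Delta>max else \<Delta> n)
            else U (Suc n) = U n \<and> \<Delta> (Suc n) = \<Delta> n / 2))"


lemma criticality_is_max:
  assumes fin: "finite_measure M" and x: "x \<in> L2 M" and G: "G x \<in> Linf M"
  shows "\<exists>f\<in>feasible M. criticality M G x = (LINT s|M. G x s * (x s - f s))"
    and "\<forall>f\<in>feasible M. (LINT s|M. G x s * (x s - f s)) \<le> criticality M G x"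
    and "criticality M G x = (LINT s|M. G x s * x s) + (LINT s|M. max (- G x s) 0)"
proof -
  interpret finite_measure M by fact
  have L2_int: "integrable M f" if "f \<in> L2 M" for f
  proof -
    have m: "f \<in> borel_measurable M" and i: "integrable M (\<lambda>s. (f s)\<^sup>2)"
      using that by (auto simp: L2_def)
    have bnd: "\<bar>t\<bar> \<le> 1 + t\<^sup>2" for t :: real
      using sum_squares_bound[of 1 "\<bar>t\<bar>"] abs_ge_zero[of t]
      unfolding power2_abs power_one by linarith
    show ?thesis
      by (rule Bochner_Integration.integrable_bound[of M "\<lambda>s. 1 + (f s)\<^sup>2"])
         (use m i bnd in auto)
  qed
  obtain K where Gm: "G x \<in> borel_measurable M" and K: "AE s in M. \<bar>G x s\<bar> \<le> K"
    using G by (auto simp: Linf_def)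
  have Gint: "integrable M (G x)"
    by (rule integrable_const_bound[where B = K]) (use Gm K in auto)
  have prod: "integrable M (\<lambda>s. G x s * f s)" if "integrable M f" for f
  proof (rule Bochner_Integration.integrable_bound[of M "\<lambda>s. K * f s"])
    show "AE s in M. norm (G x s * f s) \<le> norm (K * f s)"
      using K by eventually_elim (auto simp: abs_mult intro!: mult_right_mono)
  qed (use that Gm in auto)
  let ?neg = "LINT s|M. max (- G x s) 0"
  let ?c = "(LINT s|M. G x s * x s) + ?neg"
  have negint: "integrable M (\<lambda>s. max (- G x s) 0)"
    using Gint by auto
  have split: "(LINT s|M. G x s * (x s - f s)) = (LINT s|M. G x s * x s) - (LINT s|M. G x s * f s)"
    if "f \<in> feasible M" for f
    using that x prod[OF L2_int] by (simp add: feasible_def right_diff_distrib)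
  have upper: "(LINT s|M. G x s * (x s - f s)) \<le> ?c" if f: "f \<in> feasible M" for f
  proof -
    have "(LINT s|M. - (G x s * f s)) \<le> ?neg"
    proof (rule integral_mono_AE)
      show "integrable M (\<lambda>s. - (G x s * f s))"
        using f prod[OF L2_int] by (auto simp: feasible_def)
      have "AE s in M. 0 \<le> f s \<and> f s \<le> 1" using f by (simp add: feasible_def)
      then show "AE s in M. - (G x s * f s) \<le> max (- G x s) 0"
      proof eventually_elim
        case (elim s)
        show ?case
        proof (cases "G x s \<le> 0")
          case True
          then have "(- G x s) * f s \<le> (- G x s) * 1" using elim by (intro mult_left_mono) auto
          with True show ?thesis by simp
        next
          case False
          with elim have "0 \<le> G x s * f s" by simp
          then show ?thesis by simp
        qed
      qed
    qed (rule negint)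
    then show ?thesis using split[OF f] by simp
  qed
  define f0 :: "'a \<Rightarrow> real" where "f0 = indicator {s \<in> space M. G x s < 0}"
  have "{s \<in> space M. G x s < 0} \<in> sets M" using Gm by measurable
  then have f0m: "f0 \<in> borel_measurable M" by (simp add: f0_def)
  have "(\<lambda>s. (f0 s)\<^sup>2) = f0" by (auto simp: f0_def indicator_def fun_eq_iff)
  moreover have "integrable M f0"
    by (rule integrable_const_bound[where B = 1]) (use f0m in \<open>auto simp: f0_def indicator_def\<close>)
  ultimately have f0: "f0 \<in> feasible M"
    using f0m by (auto simp: feasible_def L2_def f0_def)
  have "(LINT s|M. - (G x s * f0 s)) = ?neg"
    by (rule Bochner_Integration.integral_cong) (auto simp: f0_def indicator_def)
  then have f0c: "(LINT s|M. G x s * (x s - f0 s)) = ?c"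
    using split[OF f0] by simp
  have sup: "criticality M G x = ?c"
    unfolding criticality_def
  proof (rule cSup_eq_maximum)
    show "?c \<in> (\<lambda>f. LINT s|M. G x s * (x s - f s)) ` feasible M"
      using f0 f0c by (intro image_eqI[where x = f0]) auto
  qed (use upper in auto)
  show "\<exists>f\<in>feasible M. criticality M G x = (LINT s|M. G x s * (x s - f s))"
    by (rule bexI[OF _ f0]) (simp only: f0c sup)
  show "\<forall>f\<in>feasible M. (LINT s|M. G x s * (x s - f s)) \<le> criticality M G x"
    using upper sup by simp
  show "criticality M G x = ?c" by (rule sup)
qed

end

theory Submission
  imports Defs
begin

text \<open>
  Write \<open>C n\<close> for the criticality of the n-th iterate. Since \<open>C n\<close> is the L1 norm of the negative part of
  \<open>g n\<close>, the best set of measure \<open>\<Delta> n\<close> gains at least the fraction \<open>\<Delta> n / \<lambda>(\<Omega>)\<close> of it, so the predicted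
  decrease is at least \<open>C n * \<Delta> n / (2 * \<lambda>(\<Omega>))\<close>. By differentiability, steps from a fixed non-critical
  iterate are accepted once the radius is small; this settles the first outcome.

  If the gradient is Lipschitz, the linearisation error is of order \<open>\<Delta> n powr (3/2)\<close>, so steps with
  \<open>\<Delta> n\<close> below a multiple of \<open>(C n)\<^sup>2\<close> are accepted. Summability of the decreases then forces
  \<open>liminf C n = 0\<close>. As long as \<open>C\<close> stays above \<open>\<epsilon>\<close>, the distance travelled by the iterates is bounded by a
  multiple of the decrease of the objective, and \<open>C\<close> is uniformly continuous along the iterates; hence \<open>C\<close>
  cannot pass from above \<open>2 * \<epsilon>\<close> to below \<open>\<epsilon>\<close> infinitely often, and \<open>C n\<close> tends to 0.

  Weak-* compactness comes from Tychonoff's theorem and the Radon-Nikodym theorem. A weak-* accumulation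
  point is the weak limit of a subsequence, and criticality passes to this limit if the gradient is
  completely continuous.
\<close>

section \<open>Function spaces over a finite measure\<close>

context finite_measure
begin

lemma L2_imp_L1: assumes "f \<in> L2 M" shows "f \<in> L1 M"
proof -
  have bnd: "\<bar>t\<bar> \<le> 1 + t\<^sup>2" for t :: real
    using sum_squares_bound[of 1 "\<bar>t\<bar>"] abs_ge_zero[of t]
    unfolding power2_abs power_one by linarith
  have "integrable M f"
    by (rule Bochner_Integration.integrable_bound[of M "\<lambda>s. 1 + (f s)\<^sup>2"])
      (use assms bnd in \<open>auto simp: L2_def\<close>)
  then show ?thesis by (simp add: L1_def)
qed

lemma Linf_mult_L1:
  assumes f: "f \<in> Linf M" and h: "h \<in> L1 M"
  shows "integrable M (\<lambda>s. f s * h s)"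
proof -
  obtain K where K: "AE s in M. \<bar>f s\<bar> \<le> K" using f by (auto simp: Linf_def)
  show ?thesis
  proof (rule Bochner_Integration.integrable_bound[of M "\<lambda>s. K * h s"])
    show "AE s in M. norm (f s * h s) \<le> norm (K * h s)"
      using K by eventually_elim (auto simp: abs_mult intro!: mult_right_mono)
  qed (use f h in \<open>auto simp: L1_def Linf_def\<close>)
qed

lemma Linf_square:
  assumes "f \<in> Linf M" shows "(\<lambda>s. (f s)\<^sup>2) \<in> Linf M"
proof -
  obtain K where K: "AE s in M. \<bar>f s\<bar> \<le> K" using assms by (auto simp: Linf_def)
  have "AE s in M. \<bar>(f s)\<^sup>2\<bar> \<le> K\<^sup>2"
    using K by eventually_elim (metis abs_ge_zero power_abs power_mono)
  then show ?thesis using assms by (auto simp: Linf_def)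
qed

lemma Linf_imp_L1: assumes "f \<in> Linf M" shows "f \<in> L1 M"
proof -
  obtain K where "AE s in M. norm (f s) \<le> K" using assms by (auto simp: Linf_def)
  moreover have "f \<in> borel_measurable M" using assms by (simp add: Linf_def)
  ultimately show ?thesis unfolding L1_def by (blast intro: integrable_const_bound)
qed

lemma Linf_imp_L2: assumes "f \<in> Linf M" shows "f \<in> L2 M"
  using Linf_imp_L1[OF Linf_square[OF assms]] assms by (auto simp: L1_def L2_def Linf_def)

lemma Linf_diff: assumes "f \<in> Linf M" "g \<in> Linf M" shows "(\<lambda>s. f s - g s) \<in> Linf M"
proof -
  obtain K L where K: "AE s in M. \<bar>f s\<bar> \<le> K" "AE s in M. \<bar>g s\<bar> \<le> L"
    using assms by (auto simp: Linf_def)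
  then have "AE s in M. \<bar>f s - g s\<bar> \<le> K + L" by eventually_elim linarith
  then show ?thesis using assms by (auto simp: Linf_def)
qed

lemma feasible_Linf: "f \<in> feasible M \<Longrightarrow> f \<in> Linf M"
proof -
  assume f: "f \<in> feasible M"
  then have "AE s in M. 0 \<le> f s \<and> f s \<le> 1" by (simp add: feasible_def)
  then have "AE s in M. \<bar>f s\<bar> \<le> 1" by eventually_elim auto
  then show ?thesis using f by (auto simp: feasible_def Linf_def L2_def)
qed

lemma indicator_feasible: "A \<in> sets M \<Longrightarrow> indicator A \<in> feasible M"
proof -
  assume A: "A \<in> sets M"
  then have "(indicator A :: 'a \<Rightarrow> real) \<in> Linf M"
    by (auto simp: Linf_def indicator_def intro!: exI[of _ 1])
  from Linf_imp_L2[OF this] show ?thesis by (auto simp: feasible_def indicator_def)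
qed

lemma indicator_L1: "A \<in> sets M \<Longrightarrow> (indicator A :: 'a \<Rightarrow> real) \<in> L1 M"
  by (simp add: indicator_feasible feasible_Linf Linf_imp_L1)

lemma L2_mult_integrable:
  assumes "f \<in> L2 M" "g \<in> L2 M" shows "integrable M (\<lambda>s. f s * g s)"
proof (rule Bochner_Integration.integrable_bound[of M "\<lambda>s. (f s)\<^sup>2 + (g s)\<^sup>2"])
  have "\<bar>x * y\<bar> \<le> \<bar>x\<^sup>2 + y\<^sup>2\<bar>" for x y :: real
    using sum_squares_bound[of "\<bar>x\<bar>" "\<bar>y\<bar>"] mult_nonneg_nonneg[of "\<bar>x\<bar>" "\<bar>y\<bar>"]
    unfolding abs_mult power2_abs by linarith
  then show "AE s in M. norm (f s * g s) \<le> norm ((f s)\<^sup>2 + (g s)\<^sup>2)" by simp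
qed (use assms in \<open>auto simp: L2_def\<close>)

text \<open>The integral of \<open>(\<bar>f s\<bar> - t * \<bar>g s\<bar>)\<^sup>2\<close> is a
  quadratic in \<open>t\<close> without negative values, so its discriminant is nonpositive.
  Absolute values under the integral give the bound for the L1 norm of the product, not only for the
  pairing.\<close>

lemma Cauchy_Schwarz_L2:
  assumes f: "f \<in> L2 M" and g: "g \<in> L2 M"
  shows "L1_norm M (\<lambda>s. f s * g s) \<le> L2_norm M f * L2_norm M g"
proof -
  have int: "integrable M (\<lambda>s. (f s)\<^sup>2)" "integrable M (\<lambda>s. (g s)\<^sup>2)"
    "integrable M (\<lambda>s. \<bar>f s * g s\<bar>)"
    using f g L2_mult_integrable[OF f g] by (auto simp: L2_def)
  define a b c where "a = (LINT s|M. (f s)\<^sup>2)" "b = (LINT s|M. \<bar>f s * g s\<bar>)" "c = (LINT s|M. (g s)\<^sup>2)"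
  have nn: "0 \<le> a" "0 \<le> b" "0 \<le> c" by (simp_all add: a_b_c_def)
  have quad: "0 \<le> a - 2 * t * b + t\<^sup>2 * c" for t
  proof -
    have "0 \<le> (LINT s|M. (\<bar>f s\<bar> - t * \<bar>g s\<bar>)\<^sup>2)" by simp
    also have "\<dots> = (LINT s|M. (f s)\<^sup>2 - 2 * t * \<bar>f s * g s\<bar> + t\<^sup>2 * (g s)\<^sup>2)"
      by (rule Bochner_Integration.integral_cong)
        (auto simp: power2_eq_square algebra_simps abs_mult)
    also have "\<dots> = a - 2 * t * b + t\<^sup>2 * c"
      using int by (simp add: a_b_c_def)
    finally show ?thesis .
  qed
  have "b\<^sup>2 \<le> a * c"
  proof (cases "c = 0")
    case True
    have "AE s in M. (g s)\<^sup>2 = 0"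
      using integral_nonneg_eq_0_iff_AE[OF int(2)] True by (simp add: a_b_c_def)
    then have "AE s in M. \<bar>f s * g s\<bar> = 0" by eventually_elim auto
    then have "b = 0" unfolding a_b_c_def by (rule integral_eq_zero_AE)
    with nn show ?thesis by simp
  next
    case False
    with nn have "c > 0" by simp
    with quad[of "b / c"] show ?thesis
      by (simp add: power2_eq_square field_simps)
  qed
  then have "b \<le> sqrt a * sqrt c"
    by (metis real_le_rsqrt real_sqrt_mult)
  then show ?thesis by (simp add: L1_norm_def L2_norm_def a_b_c_def)
qed

text \<open>Cauchy-Schwarz against an indicator, whose L2 norm is the root of the measure of its
  set.\<close>

lemma L1_norm_indicator_le:
  assumes f: "f \<in> L2 M" and A: "A \<in> sets M"
  shows "L1_norm M (\<lambda>s. f s * indicator A s) \<le> L2_norm M f * sqrt (measure M A)"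
proof -
  have "(indicator A s)\<^sup>2 = (indicator A s :: real)" for s by (auto simp: indicator_def)
  then have "L2_norm M (indicator A) = sqrt (measure M A)"
    using A sets.sets_into_space[OF A] by (simp add: L2_norm_def Int_absorb2)
  then show ?thesis
    using Cauchy_Schwarz_L2[OF f, of "indicator A"] indicator_feasible[OF A] by (simp add: feasible_def)
qed

lemma L1_norm_le_L2_norm:
  assumes f: "f \<in> L2 M"
  shows "L1_norm M f \<le> L2_norm M f * sqrt (measure M (space M))"
proof -
  have "L1_norm M f = L1_norm M (\<lambda>s. f s * indicator (space M) s)"
    unfolding L1_norm_def by (rule Bochner_Integration.integral_cong) auto
  then show ?thesis using L1_norm_indicator_le[OF f sets.top] by simp
qed

lemma L1_norm_diff_indicator:
  assumes "A \<in> sets M" "B \<in> sets M"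
  shows "L1_norm M (\<lambda>s. indicator A s - indicator B s) = measure M (sym_diff A B)"
proof -
  have "L1_norm M (\<lambda>s. indicator A s - indicator B s) = (LINT s|M. indicator (sym_diff A B) s)"
    unfolding L1_norm_def by (rule Bochner_Integration.integral_cong) (auto simp: indicator_def)
  also have "\<dots> = measure M (sym_diff A B)"
  proof -
    have "sym_diff A B \<inter> space M = sym_diff A B"
      using assms[THEN sets.sets_into_space] by blast
    then show ?thesis by simp
  qed
  finally show ?thesis .
qed

lemma measure_sym_diff_triangle:
  assumes "A \<in> sets M" "B \<in> sets M" "C \<in> sets M"
  shows "measure M (sym_diff A C) \<le> measure M (sym_diff A B) + measure M (sym_diff B C)"
proof -
  have "measure M (sym_diff A C) \<le> measure M (sym_diff A B \<union> sym_diff B C)"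
    using assms by (intro finite_measure_mono) auto
  also have "\<dots> \<le> measure M (sym_diff A B) + measure M (sym_diff B C)"
    using assms by (intro measure_Un_le) auto
  finally show ?thesis .
qed

end

section \<open>Sets of prescribed measure\<close>

text \<open>By Sierpinski's theorem, this is equivalent to being nonatomic.\<close>
definition divisible :: "'a measure \<Rightarrow> bool" where
  "divisible M \<longleftrightarrow> (\<forall>A\<in>sets M. \<forall>v. 0 \<le> v \<longrightarrow> v \<le> measure M A \<longrightarrow>
     (\<exists>B\<in>sets M. B \<subseteq> A \<and> measure M B = v))"

text \<open>Bathtub principle: \<open>E\<close> collects the largest values of \<open>h\<close>, cut
  at a level \<open>c\<close> and filled up inside the level set of \<open>c\<close> to measure
  exactly \<open>\<Delta>\<close>. Then \<open>h\<close> is at least \<open>c\<close> on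
  \<open>E\<close> and at most \<open>c\<close> outside, so its mean over \<open>E\<close> is at
  least its mean over the space. If \<open>h\<close> is positive only on a set of measure at most
  \<open>\<Delta>\<close>, that set serves as \<open>E\<close>.\<close>

lemma (in finite_measure) best_fraction:
  assumes div: "divisible M" and h: "integrable M h" and nn: "\<And>s. 0 \<le> h s"
    and \<Delta>: "0 \<le> \<Delta>" "\<Delta> \<le> measure M (space M)"
  shows "\<exists>E\<in>sets M. measure M E \<le> \<Delta> \<and> (\<forall>s\<in>E. 0 < h s) \<and>
    \<Delta> * (LINT s|M. h s) \<le> measure M (space M) * (LINT s:E|M. h s)"
proof -
  have [measurable]: "h \<in> borel_measurable M" using h by auto
  have seti: "set_integrable M A h" if "A \<in> sets M" for A
    using integrable_mult_indicator[OF that h] by (simp add: set_integrable_def)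
  define m where "m c = measure M {s \<in> space M. c < h s}" for c
  have int_nn: "0 \<le> (LINT s|M. h s)" using nn by simp
  consider "\<Delta> = 0" | "m 0 \<le> \<Delta>" | "0 < \<Delta>" "\<Delta> < m 0" using \<Delta> by linarith
  then show ?thesis
  proof cases
    case 1
    then show ?thesis by (intro bexI[of _ "{}"]) (auto simp: set_lebesgue_integral_def)
  next
    case 2
    let ?E = "{s \<in> space M. 0 < h s}"
    have "(LINT s:?E|M. h s) = (LINT s|M. h s)"
      unfolding set_lebesgue_integral_def
      by (rule Bochner_Integration.integral_cong)
        (auto simp: indicator_def not_less intro: antisym nn)
    then show ?thesis using 2 \<Delta>(2) int_nn
      by (intro bexI[of _ ?E]) (auto simp: m_def intro!: mult_right_mono)
  next
    case 3
    \<comment> \<open>The cut level is the supremum of the levels whose superlevel set is still too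
      large; Markov's inequality bounds these levels.\<close>
    define S where "S = {c. 0 \<le> c \<and> \<Delta> < m c}"
    have anti: "m d \<le> m c" if "c \<le> d" for c d
      unfolding m_def by (rule finite_measure_mono) (use that in auto)
    have markov: "c * \<Delta> \<le> (LINT s|M. h s)" if "c \<in> S" for c
    proof -
      have "c * \<Delta> \<le> c * m c" using that by (auto simp: S_def intro!: mult_left_mono)
      also have "\<dots> = (LINT s|M. c * indicator {s \<in> space M. c < h s} s)"
      proof -
        have "{s \<in> space M. c < h s} \<inter> space M = {s \<in> space M. c < h s}" by blast
        then show ?thesis by (simp add: m_def)
      qed
      also have "\<dots> \<le> (LINT s|M. h s)"
      proof (rule integral_mono)
        show "integrable M (\<lambda>s. c * indicator {s \<in> space M. c < h s} s)"
          by (intro integrable_mult_right integrable_real_indicator) (auto simp: less_top[symmetric])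
      qed (use h nn in \<open>auto simp: indicator_def\<close>)
      finally show ?thesis .
    qed
    have S0: "0 \<in> S" using 3 by (auto simp: S_def)
    have bdd: "bdd_above S"
    proof (rule bdd_aboveI)
      fix c assume "c \<in> S"
      then show "c \<le> (LINT s|M. h s) / \<Delta>" using markov[of c] 3 by (simp add: field_simps)
    qed
    define c where "c = Sup S"
    have c0: "0 \<le> c" unfolding c_def by (rule cSup_upper[OF S0 bdd])
    \<comment> \<open>No level \<open>c + 1 / Suc n\<close> lies in \<open>S\<close>, and its strict
      superlevel sets increase to that of \<open>c\<close>.\<close>
    have upper: "m c \<le> \<Delta>"
    proof -
      let ?A = "\<lambda>n::nat. {s \<in> space M. c + 1 / Suc n < h s}"
      have lim: "(\<lambda>n. measure M (?A n)) \<longlonglongrightarrow> measure M (\<Union>n. ?A n)"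
      proof (rule finite_Lim_measure_incseq)
        show "incseq ?A"
        proof (rule incseq_SucI, rule subsetI)
          fix n s assume "s \<in> ?A n"
          moreover have "1 / real (Suc (Suc n)) \<le> 1 / real (Suc n)" by (simp add: field_simps)
          ultimately show "s \<in> ?A (Suc n)" by auto
        qed
      qed auto
      have eq: "(\<Union>n. ?A n) = {s \<in> space M. c < h s}"
      proof (intro equalityI subsetI)
        fix s assume s: "s \<in> {s \<in> space M. c < h s}"
        then obtain n where "1 / Suc n < h s - c"
          using reals_Archimedean[of "h s - c"] by (auto simp: inverse_eq_divide)
        with s show "s \<in> (\<Union>n. ?A n)" by (auto simp: algebra_simps)
      next
        fix s assume "s \<in> (\<Union>n. ?A n)"
        then obtain n where n: "s \<in> space M" "c + 1 / Suc n < h s" by blast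
        have "0 < 1 / real (Suc n)" by simp
        then have "c < h s" using n(2) by linarith
        then show "s \<in> {s \<in> space M. c < h s}" using n(1) by simp
      qed
      have "measure M (?A n) \<le> \<Delta>" for n
      proof (rule ccontr)
        assume "\<not> measure M (?A n) \<le> \<Delta>"
        then have "c + 1 / Suc n \<in> S" using c0 by (auto simp: S_def m_def)
        then have "c + 1 / Suc n \<le> c" unfolding c_def by (rule cSup_upper[OF _ bdd])
        then show False by (simp add: field_simps)
      qed
      then show ?thesis unfolding m_def
        by (intro LIMSEQ_le_const2[OF lim[unfolded eq]] exI[of _ 0] allI impI)
    qed
    \<comment> \<open>In this case \<open>m 0\<close> exceeds \<open>\<Delta>\<close>, so
      \<open>upper\<close> excludes \<open>c = 0\<close>; a positive level puts \<open>E\<close>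
      where \<open>h\<close> is positive.\<close>
    have cpos: "0 < c" using upper 3 c0 by (cases "c = 0") auto
    \<comment> \<open>Each level below \<open>c\<close> is exceeded by a member of \<open>S\<close>;
      the superlevel sets decrease to the non-strict one of \<open>c\<close>.\<close>
    have lower: "\<Delta> \<le> measure M {s \<in> space M. c \<le> h s}"
    proof -
      let ?A = "\<lambda>n::nat. {s \<in> space M. c - 1 / Suc n < h s}"
      have lim: "(\<lambda>n. measure M (?A n)) \<longlonglongrightarrow> measure M (\<Inter>n. ?A n)"
      proof (rule finite_Lim_measure_decseq)
        show "decseq ?A"
        proof (rule decseq_SucI, rule subsetI)
          fix n s assume "s \<in> ?A (Suc n)"
          moreover have "1 / real (Suc (Suc n)) \<le> 1 / real (Suc n)" by (simp add: field_simps)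
          ultimately show "s \<in> ?A n" by auto
        qed
      qed auto
      have eq: "(\<Inter>n. ?A n) = {s \<in> space M. c \<le> h s}"
      proof (intro equalityI subsetI)
        fix s assume s: "s \<in> (\<Inter>n. ?A n)"
        then have *: "c - 1 / Suc n < h s" for n by blast
        have "c \<le> h s"
        proof (rule ccontr)
          assume "\<not> c \<le> h s"
          then obtain n where "1 / Suc n < c - h s"
            using reals_Archimedean[of "c - h s"] by (auto simp: inverse_eq_divide)
          with *[of n] show False by linarith
        qed
        with s show "s \<in> {s \<in> space M. c \<le> h s}" by auto
      next
        fix s assume s: "s \<in> {s \<in> space M. c \<le> h s}"
        have "s \<in> ?A n" for n
        proof -
          have "0 < 1 / real (Suc n)" by simp
          then have "c - 1 / real (Suc n) < c" by linarith
          also have "c \<le> h s" using s by simp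
          finally show ?thesis using s by simp
        qed
        then show "s \<in> (\<Inter>n. ?A n)" by blast
      qed
      have "\<Delta> \<le> measure M (?A n)" for n
      proof -
        have "c - 1 / Suc n < Sup S" by (simp add: c_def)
        then obtain d where "d \<in> S" "c - 1 / Suc n < d" using less_cSupE S0 by blast
        then show ?thesis using anti[of "c - 1 / Suc n" d] by (auto simp: S_def m_def)
      qed
      then show ?thesis
        by (intro LIMSEQ_le_const[OF lim[unfolded eq]] exI[of _ 0] allI impI)
    qed
    let ?H = "{s \<in> space M. c < h s}" and ?C = "{s \<in> space M. h s = c}"
    have Cm: "?C \<in> sets M"
    proof -
      have "?C = h -` {c} \<inter> space M" by auto
      then show ?thesis using measurable_sets[of h M borel "{c}"] by simp
    qed
    have Hm: "?H \<in> sets M" by measurable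
    have "measure M {s \<in> space M. c \<le> h s} = measure M (?H \<union> ?C)"
      by (rule arg_cong[where f = "measure M"]) auto
    also have "\<dots> = m c + measure M ?C"
      unfolding m_def by (rule finite_measure_Union[OF Hm Cm]) auto
    finally have "\<Delta> - m c \<le> measure M ?C" using lower by simp
    moreover have "0 \<le> \<Delta> - m c" using upper by simp
    \<comment> \<open>Divisibility splits the level set: the piece \<open>B\<close> completes
      \<open>?H\<close> to measure exactly \<open>\<Delta>\<close>.\<close>
    ultimately obtain B where B: "B \<in> sets M" "B \<subseteq> ?C" "measure M B = \<Delta> - m c"
      using div Cm unfolding divisible_def by blast
    define E where "E = ?H \<union> B"
    have E: "E \<in> sets M" using B(1) Hm by (simp add: E_def)
    have "measure M E = m c + measure M B"
      unfolding m_def E_def by (rule finite_measure_Union[OF Hm B(1)]) (use B(2) in auto)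
    then have mE: "measure M E = \<Delta>" using B by simp
    have gec: "c \<le> h s" if "s \<in> E" for s using that B by (auto simp: E_def)
    have lec: "h s \<le> c" if "s \<in> space M - E" for s using that by (auto simp: E_def not_less)
    have "(LINT s:E|M. c) \<le> (LINT s:E|M. h s)"
      by (rule set_integral_mono) (use seti E gec in \<open>auto simp: set_integrable_def less_top[symmetric]\<close>)
    then have 1: "c * \<Delta> \<le> (LINT s:E|M. h s)"
      using E sets.sets_into_space[OF E]
      by (simp add: set_lebesgue_integral_def mE Int_absorb2 mult.commute)
    have "(LINT s:(space M - E)|M. h s) \<le> (LINT s:(space M - E)|M. c)"
      by (rule set_integral_mono) (use seti E lec in \<open>auto simp: set_integrable_def less_top[symmetric]\<close>)
    then have 2: "(LINT s:(space M - E)|M. h s) \<le> c * (measure M (space M) - \<Delta>)"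
      using E by (simp add: set_lebesgue_integral_def Int_absorb2 finite_measure_compl mE mult.commute)
    have "(LINT s|M. h s) = (LINT s:(E \<union> (space M - E))|M. h s)"
      using sets.sets_into_space[OF E]
      by (simp add: set_lebesgue_integral_def Un_absorb1)
        (rule Bochner_Integration.integral_cong, auto)
    also have "\<dots> = (LINT s:E|M. h s) + (LINT s:(space M - E)|M. h s)"
      by (rule set_integral_Un) (use seti E in auto)
    finally have 3: "(LINT s|M. h s) = (LINT s:E|M. h s) + (LINT s:(space M - E)|M. h s)" .
    have "\<Delta> * (LINT s:(space M - E)|M. h s) \<le> \<Delta> * (c * (measure M (space M) - \<Delta>))"
      using 2 \<Delta> by (intro mult_left_mono) auto
    also have "\<dots> = (measure M (space M) - \<Delta>) * (c * \<Delta>)" by simp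
    also have "\<dots> \<le> (measure M (space M) - \<Delta>) * (LINT s:E|M. h s)"
      using 1 \<Delta> by (intro mult_left_mono) auto
    finally have "\<Delta> * (LINT s|M. h s) \<le> measure M (space M) * (LINT s:E|M. h s)"
      by (simp add: 3 algebra_simps)
    moreover have "\<forall>s\<in>E. 0 < h s" using gec cpos by fastforce
    ultimately show ?thesis using E mE by auto
  qed
qed

lemma finite_measure_lborel_on:
  assumes "bounded \<Omega>" "\<Omega> \<in> sets borel"
  shows "finite_measure (lborel_on \<Omega>)"
proof
  have "emeasure lborel \<Omega> < \<infinity>" using assms emeasure_bounded_finite by auto
  then show "emeasure (lborel_on \<Omega>) (space (lborel_on \<Omega>)) \<noteq> \<infinity>"
    using assms by (simp add: space_restrict_space emeasure_restrict_space)
qed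

text \<open>Concentric balls sweep through \<open>A\<close>: the measure of
  \<open>A \<inter> cball 0 r\<close> is continuous in \<open>r\<close>, since its increments are
  dominated by those of the volume of the ball, and the intermediate value theorem applies.\<close>

lemma divisible_lborel_on:
  fixes \<Omega> :: "'a::euclidean_space set"
  assumes bdd: "bounded \<Omega>" and \<Omega>: "\<Omega> \<in> sets borel"
  shows "divisible (lborel_on \<Omega>)"
  unfolding divisible_def
proof (intro ballI allI impI)
  fix A v assume A: "A \<in> sets (lborel_on \<Omega>)" and v: "0 \<le> v" "v \<le> measure (lborel_on \<Omega>) A"
  have A': "A \<in> sets borel" "A \<subseteq> \<Omega>" using A \<Omega> by (auto simp: sets_restrict_space_iff)
  have meas: "measure (lborel_on \<Omega>) B = measure lborel B" if "B \<subseteq> \<Omega>" for B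
    using that \<Omega> by (intro measure_restrict_space) auto
  define F where "F r = measure lborel (A \<inter> cball 0 r)" for r
  let ?V = "\<lambda>r. measure lborel (cball (0::'a) r)"
  have fin: "emeasure lborel (cball (0::'a) r) < \<infinity>" for r by (rule emeasure_lborel_cball_finite)
  have fm: "B \<in> fmeasurable lborel" if "B \<subseteq> cball (0::'a) r" "B \<in> sets borel" for B r
    by (rule fmeasurableI) (use that fin[of r] emeasure_mono[of B "cball 0 r" lborel] in auto)
  have V: "?V r = unit_ball_vol (real DIM('a)) * r ^ DIM('a)" if "0 \<le> r" for r
    using content_cball[OF that, of "0::'a"] by simp
  have mono: "\<bar>F t - F r\<bar> \<le> \<bar>?V t - ?V r\<bar>" if "r \<le> t" for r t
  proof -
    have sub: "cball 0 r \<subseteq> cball (0::'a) t" using that by auto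
    have *: "F t - F r = measure lborel ((A \<inter> cball 0 t) - (A \<inter> cball 0 r))"
      unfolding F_def
      by (rule measure_Diff[symmetric]) (use sub A' fm[of "A \<inter> cball 0 t" t] in \<open>auto simp: fmeasurable_def\<close>)
    have **: "?V t - ?V r = measure lborel (cball 0 t - cball (0::'a) r)"
      by (rule measure_Diff[symmetric]) (use sub fin[of t] in auto)
    have "measure lborel ((A \<inter> cball 0 t) - (A \<inter> cball 0 r)) \<le> measure lborel (cball 0 t - cball (0::'a) r)"
      by (rule measure_mono_fmeasurable) (use A' fm[of _ t] in auto)
    then show ?thesis unfolding * ** by simp
  qed
  have bound: "\<bar>F t - F r\<bar> \<le> \<bar>?V t - ?V r\<bar>" for r t
    using mono[of r t] mono[of t r] by (cases "r \<le> t") (auto simp: abs_minus_commute)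
  have contV: "continuous_on {0..} ?V"
  proof -
    have "continuous_on {0..} (\<lambda>r::real. unit_ball_vol (real DIM('a)) * r ^ DIM('a))"
      by (intro continuous_intros)
    then show ?thesis by (rule continuous_on_eq) (simp add: V)
  qed
  have cont: "continuous_on {0..} F"
    unfolding continuous_on_def
  proof
    fix r :: real assume "r \<in> {0..}"
    then have "(?V \<longlongrightarrow> ?V r) (at r within {0..})" using contV by (auto simp: continuous_on_def)
    then have "((\<lambda>t. ?V t - ?V r) \<longlongrightarrow> 0) (at r within {0..})" by (simp add: LIM_zero_iff)
    then have "((\<lambda>t. F t - F r) \<longlongrightarrow> 0) (at r within {0..})"
      by (rule Lim_null_comparison[OF always_eventually, rotated, OF tendsto_rabs_zero])
        (use bound in auto)
    then show "(F \<longlongrightarrow> F r) (at r within {0..})" by (simp add: LIM_zero_iff)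
  qed
  obtain R where R: "0 < R" "\<Omega> \<subseteq> cball 0 R" using bounded_subset_ballD[OF bdd, of 0]
    by (meson ball_subset_cball order_trans)
  \<comment> \<open>A ball of radius 0 is a single point, so the sweep starts at 0; it ends once the
    ball contains \<open>\<Omega>\<close>.\<close>
  have "F 0 \<le> 0"
    using measure_mono_fmeasurable[of "A \<inter> cball 0 0" "cball 0 0" lborel] A' fm[of _ 0] V[of 0]
    by (auto simp: F_def)
  moreover have "F R = measure (lborel_on \<Omega>) A"
    using R A' by (simp add: F_def meas Int_absorb2)
  ultimately obtain r where r: "0 \<le> r" "F r = v"
    using IVT'[of F 0 v R] v R continuous_on_subset[OF cont, of "{0..R}"] by auto
  show "\<exists>B\<in>sets (lborel_on \<Omega>). B \<subseteq> A \<and> measure (lborel_on \<Omega>) B = v"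
  proof (intro bexI conjI)
    show "measure (lborel_on \<Omega>) (A \<inter> cball 0 r) = v"
      using r A' meas[of "A \<inter> cball 0 r"] by (auto simp: F_def)
    show "A \<inter> cball 0 r \<in> sets (lborel_on \<Omega>)"
      using A' \<Omega> by (auto simp: sets_restrict_space_iff)
  qed auto
qed

section \<open>Weak-* compactness\<close>

context finite_measure
begin

lemma feasible_L1: "f \<in> feasible M \<Longrightarrow> f \<in> L1 M"
  by (simp add: feasible_Linf Linf_imp_L1)

lemma feasible_mult_integrable: "f \<in> feasible M \<Longrightarrow> \<phi> \<in> L1 M \<Longrightarrow> integrable M (\<lambda>s. f s * \<phi> s)"
  by (simp add: feasible_Linf Linf_mult_L1)

text \<open>The bound depends on \<open>\<phi>\<close> alone: it confines the pairings of all
  feasible functions with \<open>\<phi>\<close> to one compact interval.\<close>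

lemma feasible_pairing_bound:
  assumes f: "f \<in> feasible M" and \<phi>: "\<phi> \<in> L1 M"
  shows "\<bar>LINT s|M. f s * \<phi> s\<bar> \<le> L1_norm M \<phi>"
proof -
  have "\<bar>LINT s|M. f s * \<phi> s\<bar> \<le> (LINT s|M. \<bar>f s * \<phi> s\<bar>)" by (rule integral_abs_bound)
  also have "\<dots> \<le> L1_norm M \<phi>"
    unfolding L1_norm_def
  proof (rule integral_mono_AE)
    have "AE s in M. 0 \<le> f s \<and> f s \<le> 1" using f by (simp add: feasible_def)
    then show "AE s in M. \<bar>f s * \<phi> s\<bar> \<le> \<bar>\<phi> s\<bar>"
      by eventually_elim (simp add: abs_mult mult_left_le_one_le)
  qed (use feasible_mult_integrable[OF f \<phi>] \<phi> in \<open>auto simp: L1_def\<close>)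
  finally show ?thesis .
qed

lemma feasible_pairing_indicator:
  assumes f: "f \<in> feasible M" and A: "A \<in> sets M"
  shows "0 \<le> (LINT s|M. f s * indicator A s)" "(LINT s|M. f s * indicator A s) \<le> measure M A"
proof -
  have ae: "AE s in M. 0 \<le> f s \<and> f s \<le> 1" using f by (simp add: feasible_def)
  then have "AE s in M. 0 \<le> f s * indicator A s" by eventually_elim simp
  then show "0 \<le> (LINT s|M. f s * indicator A s)" by (rule integral_nonneg_AE)
  have "(LINT s|M. f s * indicator A s) \<le> (LINT s|M. indicator A s)"
  proof (rule integral_mono_AE)
    show "AE s in M. f s * indicator A s \<le> indicator A s"
      using ae by eventually_elim (simp add: mult_left_le_one_le)
  qed (use feasible_mult_integrable[OF f indicator_L1[OF A]] indicator_L1[OF A] in \<open>auto simp: L1_def\<close>)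
  then show "(LINT s|M. f s * indicator A s) \<le> measure M A"
    using sets.sets_into_space[OF A] by (simp add: Int_absorb2)
qed

text \<open>Radon-Nikodym: the values of \<open>\<Phi>\<close> on indicators form a measure
  dominated by \<open>M\<close>, whose density lies between 0 and 1 a.e. Both sides are linear and
  continuous for the L1 norm, so the representation passes from indicators to all of L1.\<close>

lemma functional_is_feasible:
  assumes add: "\<And>\<phi> \<psi>. \<phi> \<in> L1 M \<Longrightarrow> \<psi> \<in> L1 M \<Longrightarrow> \<Phi> (\<lambda>s. \<phi> s + \<psi> s) = \<Phi> \<phi> + \<Phi> \<psi>"
    and scale: "\<And>c \<phi>. \<phi> \<in> L1 M \<Longrightarrow> \<Phi> (\<lambda>s. c * \<phi> s) = c * \<Phi> \<phi>"
    and bound: "\<And>\<phi>. \<phi> \<in> L1 M \<Longrightarrow> \<bar>\<Phi> \<phi>\<bar> \<le> L1_norm M \<phi>"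
    and pos: "\<And>A. A \<in> sets M \<Longrightarrow> 0 \<le> \<Phi> (indicator A)"
  obtains f where "f \<in> feasible M" "\<And>\<phi>. \<phi> \<in> L1 M \<Longrightarrow> \<Phi> \<phi> = (LINT s|M. f s * \<phi> s)"
proof -
  define \<nu> where "\<nu> A = \<Phi> (indicator A)" for A
  have \<nu>_nn: "0 \<le> \<nu> A" if "A \<in> sets M" for A using pos that by (simp add: \<nu>_def)
  have \<nu>_le: "\<nu> A \<le> measure M A" if A: "A \<in> sets M" for A
  proof -
    have "L1_norm M (indicator A) = measure M A"
      using sets.sets_into_space[OF A] by (simp add: L1_norm_def Int_absorb2)
    then show ?thesis using bound[OF indicator_L1[OF A]] by (simp add: \<nu>_def)
  qed
  have \<nu>_add: "\<nu> (A \<union> B) = \<nu> A + \<nu> B" if "A \<in> sets M" "B \<in> sets M" "A \<inter> B = {}" for A B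
  proof -
    have "(indicator (A \<union> B) :: 'a \<Rightarrow> real) = (\<lambda>s. indicator A s + indicator B s)"
      using that by (auto simp: indicator_def fun_eq_iff)
    then show ?thesis using add indicator_L1 that by (simp add: \<nu>_def)
  qed
  have \<nu>_empty: "\<nu> {} = 0" using \<nu>_nn[of "{}"] \<nu>_le[of "{}"] by simp
  have "countably_additive (sets M) (\<lambda>A. ennreal (\<nu> A))"
  \<comment> \<open>For a finite additive set function, continuity at the empty set gives countable
    additivity; \<open>\<nu>\<close> inherits this continuity from \<open>M\<close> by
    domination.\<close>
  proof (rule sets.empty_continuous_imp_countably_additive)
    show "positive (sets M) (\<lambda>A. ennreal (\<nu> A))" using \<nu>_empty by (simp add: positive_def)
    show "additive (sets M) (\<lambda>A. ennreal (\<nu> A))"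
      using \<nu>_add \<nu>_nn by (auto simp: additive_def ennreal_plus)
  next
    fix A :: "nat \<Rightarrow> 'a set"
    assume A: "range A \<subseteq> sets M" "decseq A" "(\<Inter>i. A i) = {}"
    then have As: "A i \<in> sets M" for i by auto
    have "(\<lambda>i. measure M (A i)) \<longlonglongrightarrow> 0"
      using finite_Lim_measure_decseq[OF A(1,2)] A(3) by simp
    then have "(\<lambda>i. \<nu> (A i)) \<longlonglongrightarrow> 0"
      by (rule tendsto_sandwich[OF _ _ tendsto_const, rotated 2]) (use \<nu>_nn \<nu>_le As in auto)
    then show "(\<lambda>i. ennreal (\<nu> (A i))) \<longlonglongrightarrow> 0"
      using tendsto_ennrealI by force
  qed simp
  moreover define N where "N = measure_of (space M) (sets M) (\<lambda>A. ennreal (\<nu> A))"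
  ultimately have em: "emeasure N A = ennreal (\<nu> A)" if "A \<in> sets M" for A
    using that \<nu>_empty unfolding N_def
    by (intro emeasure_measure_of_sigma) (auto simp: positive_def sets.sigma_algebra_axioms)
  have N_sets: "sets N = sets M" by (simp add: N_def)
  have "absolutely_continuous M N"
    unfolding absolutely_continuous_def
  proof
    fix A assume "A \<in> null_sets M"
    then have A: "A \<in> sets M" "measure M A = 0" by (auto simp: measure_def)
    then have "\<nu> A = 0" using \<nu>_nn \<nu>_le by (metis antisym)
    then show "A \<in> null_sets N" using A em N_sets by (auto simp: null_sets_def)
  qed
  from Radon_Nikodym[OF this N_sets] obtain g where g: "g \<in> borel_measurable M" "density M g = N" by blast
  have g_nn: "(\<integral>\<^sup>+s. g s * indicator A s \<partial>M) = ennreal (\<nu> A)" if "A \<in> sets M" for A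
    using emeasure_density[OF g(1) that] g(2) em[OF that] by simp
  have g1: "AE s in M. g s \<le> 1"
  proof -
    let ?A = "{s \<in> space M. 1 < g s}"
    have A: "?A \<in> sets M" using g(1) by measurable
    \<comment> \<open>The excess of \<open>g\<close> over 1 on \<open>?A\<close> is added rather
      than subtracted; finiteness of \<open>emeasure M ?A\<close> then allows the cancellation that
      leaves an excess with integral 0.\<close>
    have "emeasure M ?A + (\<integral>\<^sup>+s. (g s - 1) * indicator ?A s \<partial>M)
        = (\<integral>\<^sup>+s. indicator ?A s + (g s - 1) * indicator ?A s \<partial>M)"
      using g(1) A by (simp add: nn_integral_add)
    also have "\<dots> = (\<integral>\<^sup>+s. g s * indicator ?A s \<partial>M)"
      by (rule nn_integral_cong) (auto simp: indicator_def add_diff_inverse_ennreal)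
    also have "\<dots> \<le> emeasure M ?A"
      using g_nn[OF A] \<nu>_le[OF A] by (simp add: emeasure_eq_measure)
    finally have "emeasure M ?A + (\<integral>\<^sup>+s. (g s - 1) * indicator ?A s \<partial>M) \<le> emeasure M ?A + 0" by simp
    then have "(\<integral>\<^sup>+s. (g s - 1) * indicator ?A s \<partial>M) \<le> 0"
      unfolding ennreal_add_left_cancel_le by simp
    then have "AE s in M. (g s - 1) * indicator ?A s = 0"
      using g(1) A by (subst (asm) le_zero_eq, subst (asm) nn_integral_0_iff_AE) auto
    then show ?thesis
      by (rule AE_mp) (rule AE_I2, auto simp: indicator_def not_less ennreal_minus_eq_0 split: if_splits)
  qed
  define f where "f s = enn2real (g s)" for s
  have fg: "AE s in M. ennreal (f s) = g s"
    using g1 by eventually_elim (simp add: f_def le_less_trans[OF _ ennreal_one_less_top])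
  have f_meas: "f \<in> borel_measurable M" unfolding f_def[abs_def] using g(1) by measurable
  have f01: "AE s in M. 0 \<le> f s \<and> f s \<le> 1"
    using g1 by eventually_elim (auto simp: f_def dest: enn2real_mono)
  have "f \<in> Linf M"
    unfolding Linf_def using f_meas f01 by (auto intro!: exI[of _ 1] elim: eventually_mono)
  then have f: "f \<in> feasible M" using f01 Linf_imp_L2 by (simp add: feasible_def)
  have ind: "\<Phi> (indicator A) = (LINT s|M. f s * indicator A s)" if A: "A \<in> sets M" for A
  proof -
    have "ennreal (LINT s|M. f s * indicator A s) = (\<integral>\<^sup>+s. ennreal (f s * indicator A s) \<partial>M)"
      by (rule nn_integral_eq_integral[symmetric])
        (use feasible_mult_integrable[OF f indicator_L1[OF A]] f01 in auto)
    also have "\<dots> = (\<integral>\<^sup>+s. g s * indicator A s \<partial>M)"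
      by (rule nn_integral_cong_AE, rule AE_mp[OF fg], rule AE_I2) (auto simp: indicator_def)
    finally show ?thesis
      using g_nn[OF A] \<nu>_nn[OF A] feasible_pairing_indicator(1)[OF f A] by (simp add: \<nu>_def)
  qed
  have "\<Phi> \<phi> = (LINT s|M. f s * \<phi> s)" if "\<phi> \<in> L1 M" for \<phi>
  proof -
    have "integrable M \<phi>" using that by (simp add: L1_def)
    then show ?thesis
    proof (induction rule: integrable_induct)
      case (base A c)
      have eq: "(\<lambda>s. indicator A s *\<^sub>R c) = (\<lambda>s. c * indicator A s)" by (auto simp: mult.commute)
      have "(LINT s|M. f s * (indicator A s *\<^sub>R c)) = (LINT s|M. c * (f s * indicator A s))"
        by (rule Bochner_Integration.integral_cong) auto
      also have "\<dots> = \<Phi> (\<lambda>s. c * indicator A s)"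
        using scale[OF indicator_L1[OF base(1)]] ind[OF base(1)] by simp
      finally show ?case unfolding eq by simp
    next
      case (add \<phi> \<psi>)
      then have "\<phi> \<in> L1 M" "\<psi> \<in> L1 M" by (auto simp: L1_def)
      then show ?case
        using add(3,4) \<open>\<And>\<phi> \<psi>. \<phi> \<in> L1 M \<Longrightarrow> \<psi> \<in> L1 M \<Longrightarrow> \<Phi> (\<lambda>s. \<phi> s + \<psi> s) = \<Phi> \<phi> + \<Phi> \<psi>\<close>
          feasible_mult_integrable[OF f] by (simp add: distrib_left)
    next
      case (lim \<phi> S)
      have L: "\<phi> \<in> L1 M" "S i \<in> L1 M" for i using lim by (auto simp: L1_def)
      then have Ld: "(\<lambda>s. S i s - \<phi> s) \<in> L1 M" for i by (auto simp: L1_def)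
      \<comment> \<open>The approximants are bounded by \<open>2 * \<bar>\<phi> s\<bar>\<close>,
        hence the dominating function \<open>3 * \<bar>\<phi> s\<bar>\<close>.\<close>
      have "(\<lambda>i. LINT s|M. \<bar>S i s - \<phi> s\<bar>) \<longlonglongrightarrow> (LINT s|M. 0)"
      proof (rule integral_dominated_convergence[where w = "\<lambda>s. 3 * \<bar>\<phi> s\<bar>"])
        show "AE s in M. (\<lambda>i. \<bar>S i s - \<phi> s\<bar>) \<longlonglongrightarrow> 0"
          using lim.hyps(2) by (intro AE_I2 tendsto_rabs_zero LIM_zero) simp
        show "AE s in M. norm \<bar>S i s - \<phi> s\<bar> \<le> 3 * \<bar>\<phi> s\<bar>" for i
          using lim.hyps(3)[of _ i] by (intro AE_I2) (simp, smt (verit))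
      qed (use lim.hyps in auto)
      then have small: "(\<lambda>i. L1_norm M (\<lambda>s. S i s - \<phi> s)) \<longlonglongrightarrow> 0"
        by (simp add: L1_norm_def)
      have \<Phi>d: "\<Phi> (\<lambda>s. S i s - \<phi> s) = \<Phi> (S i) - \<Phi> \<phi>" for i
        using add[OF Ld L(1), of i] by simp
      have Id: "(LINT s|M. f s * (S i s - \<phi> s)) = (LINT s|M. f s * S i s) - (LINT s|M. f s * \<phi> s)" for i
        using feasible_mult_integrable[OF f] L by (simp add: right_diff_distrib)
      have "(\<lambda>i. \<Phi> (S i) - \<Phi> \<phi>) \<longlonglongrightarrow> 0"
        by (rule Lim_null_comparison[OF always_eventually small]) (use bound[OF Ld] \<Phi>d in auto)
      then have 1: "(\<lambda>i. \<Phi> (S i)) \<longlonglongrightarrow> \<Phi> \<phi>" by (simp add: LIM_zero_iff)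
      have "(\<lambda>i. (LINT s|M. f s * S i s) - (LINT s|M. f s * \<phi> s)) \<longlonglongrightarrow> 0"
        by (rule Lim_null_comparison[OF always_eventually small])
          (use feasible_pairing_bound[OF f Ld] Id in auto)
      then have "(\<lambda>i. \<Phi> (S i)) \<longlonglongrightarrow> (LINT s|M. f s * \<phi> s)"
        using lim.IH by (simp add: LIM_zero_iff)
      with 1 show ?case by (rule LIMSEQ_unique)
    qed
  qed
  with f show thesis using that by blast
qed

text \<open>Tychonoff: the pairings live in a product of compact intervals, so their image filter
  has a cluster point. It is linear as a limit of linear functionals, hence given by a feasible
  function. A finer filter takes the place of a subsequence, since a cluster point in an uncountable
  product need not be the limit of one; a general \<open>F\<close> allows a start from any infinite
  set of indices.\<close>

lemma feasible_weak_star_compact: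
  assumes X: "\<And>n. X n \<in> feasible M" and F: "F \<noteq> bot"
  obtains f K where "f \<in> feasible M" "K \<le> F" "K \<noteq> bot"
    "\<And>\<phi>. \<phi> \<in> L1 M \<Longrightarrow> ((\<lambda>n. LINT s|M. X n s * \<phi> s) \<longlongrightarrow> (LINT s|M. f s * \<phi> s)) K"
proof -
  define P where "P n \<phi> = (if \<phi> \<in> L1 M then LINT s|M. X n s * \<phi> s else 0)" for n \<phi>
  \<comment> \<open>Outside L1 the coordinate is pinned to 0, so that the product is indexed by all
    functions and carries the topology of the function type.\<close>
  define B where "B \<phi> = (if \<phi> \<in> L1 M then {- L1_norm M \<phi>..L1_norm M \<phi>} else {0})" for \<phi>
  have "compactin (product_topology (\<lambda>_. euclidean) UNIV) (PiE UNIV B)"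
    by (simp add: compactin_PiE B_def)
  then have comp: "compact (PiE UNIV B)" by (simp add: euclidean_product_topology)
  have PB: "P n \<in> PiE UNIV B" for n
    using feasible_pairing_bound[OF X] by (auto simp: P_def B_def abs_le_iff minus_le_iff)
  have "filtermap P F \<noteq> bot" using F by (simp add: filtermap_bot_iff)
  then obtain \<Phi> where \<Phi>: "inf (nhds \<Phi>) (filtermap P F) \<noteq> bot"
    using compact_filter[THEN iffD1, OF comp, rule_format, of "filtermap P F"] PB
    by (auto simp: eventually_filtermap)
  \<comment> \<open>Pulling the neighbourhoods of \<open>\<Phi>\<close> back along \<open>P\<close>
    turns the cluster point into a limit; \<open>K\<close> is proper because \<open>\<Phi>\<close>
    is a cluster point.\<close>
  define K where "K = inf (filtercomap P (nhds \<Phi>)) F"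
  have KF: "K \<le> F" by (simp add: K_def)
  have K: "K \<noteq> bot"
  proof
    assume "K = bot"
    then have "eventually (\<lambda>_. False) K" by simp
    then obtain Q R where QR: "eventually Q (filtercomap P (nhds \<Phi>))" "eventually R F"
      "\<And>n. Q n \<Longrightarrow> R n \<Longrightarrow> False"
      unfolding K_def eventually_inf by blast
    then obtain Q' where Q': "eventually Q' (nhds \<Phi>)" "\<And>n. Q' (P n) \<Longrightarrow> Q n"
      unfolding eventually_filtercomap by blast
    have "eventually (\<lambda>n. \<not> Q' (P n)) F" using QR(2) by eventually_elim (use QR(3) Q'(2) in blast)
    then have "eventually (\<lambda>y. \<not> Q' y) (filtermap P F)" by (simp add: eventually_filtermap)
    then have "eventually (\<lambda>_. False) (inf (nhds \<Phi>) (filtermap P F))"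
      unfolding eventually_inf using Q'(1) by blast
    with \<Phi> show False by (simp add: eventually_False)
  qed
  have "filterlim P (nhds \<Phi>) K"
    unfolding K_def filterlim_iff_le_filtercomap by simp
  then have "((\<lambda>n. P n \<phi>) \<longlongrightarrow> \<Phi> \<phi>) K" for \<phi>
  proof (intro topological_tendstoI)
    fix S :: "real set" assume S: "open S" "\<Phi> \<phi> \<in> S"
    have "open ((\<lambda>x. x \<phi>) -` S)"
      by (rule open_vimage[OF S(1) continuous_on_product_coordinates])
    with S have ev: "\<forall>\<^sub>F x in nhds \<Phi>. x \<phi> \<in> S"
      by (auto simp: eventually_nhds intro!: exI[of _ "(\<lambda>x. x \<phi>) -` S"])
    show "\<forall>\<^sub>F n in K. P n \<phi> \<in> S"
      by (rule eventually_compose_filterlim[OF ev \<open>filterlim P (nhds \<Phi>) K\<close>])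
  qed
  have lim: "((\<lambda>n. LINT s|M. X n s * \<phi> s) \<longlongrightarrow> \<Phi> \<phi>) K" if \<phi>: "\<phi> \<in> L1 M" for \<phi>
  proof -
    have "(\<lambda>n. P n \<phi>) = (\<lambda>n. LINT s|M. X n s * \<phi> s)" using \<phi> by (simp add: P_def)
    with \<open>\<And>\<phi>. ((\<lambda>n. P n \<phi>) \<longlongrightarrow> \<Phi> \<phi>) K\<close>[of \<phi>] show ?thesis by simp
  qed
  have unique: "\<Phi> \<phi> = l" if "\<phi> \<in> L1 M" "((\<lambda>n. LINT s|M. X n s * \<phi> s) \<longlongrightarrow> l) K" for \<phi> l
    using tendsto_unique[OF K lim that(2)] that(1) by blast
  note int = feasible_mult_integrable[OF X]
  obtain f where f: "f \<in> feasible M"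
    and f\<Phi>: "\<And>\<phi>. \<phi> \<in> L1 M \<Longrightarrow> \<Phi> \<phi> = (LINT s|M. f s * \<phi> s)"
  proof (rule functional_is_feasible)
    fix \<phi> \<psi> assume *: "\<phi> \<in> L1 M" "\<psi> \<in> L1 M"
    show "\<Phi> (\<lambda>s. \<phi> s + \<psi> s) = \<Phi> \<phi> + \<Phi> \<psi>"
    proof (rule unique)
      show "((\<lambda>n. LINT s|M. X n s * (\<phi> s + \<psi> s)) \<longlongrightarrow> \<Phi> \<phi> + \<Phi> \<psi>) K"
        using tendsto_add[OF lim[OF *(1)] lim[OF *(2)]] int * by (simp add: distrib_left)
    qed (use * in \<open>auto simp: L1_def\<close>)
  next
    fix c \<phi> assume *: "\<phi> \<in> L1 M"
    show "\<Phi> (\<lambda>s. c * \<phi> s) = c * \<Phi> \<phi>"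
    proof (rule unique)
      show "((\<lambda>n. LINT s|M. X n s * (c * \<phi> s)) \<longlongrightarrow> c * \<Phi> \<phi>) K"
        using tendsto_mult_left[OF lim[OF *], of c] by (simp add: mult.left_commute)
    qed (use * in \<open>auto simp: L1_def\<close>)
  next
    fix \<phi> assume *: "\<phi> \<in> L1 M"
    show "\<bar>\<Phi> \<phi>\<bar> \<le> L1_norm M \<phi>"
      by (rule tendsto_upperbound[OF tendsto_rabs[OF lim[OF *]] always_eventually K])
        (use feasible_pairing_bound[OF X *] in auto)
  next
    fix A assume A: "A \<in> sets M"
    show "0 \<le> \<Phi> (indicator A)"
      by (rule tendsto_lowerbound[OF lim[OF indicator_L1[OF A]] always_eventually K])
        (use feasible_pairing_indicator(1)[OF X A] in auto)
  qed blast
  show thesis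
  proof (rule that[OF f KF K])
    show "((\<lambda>n. LINT s|M. X n s * \<phi> s) \<longlongrightarrow> (LINT s|M. f s * \<phi> s)) K" if "\<phi> \<in> L1 M" for \<phi>
      using lim[OF that] f\<Phi>[OF that] by simp
  qed
qed

text \<open>Limits in the product topology are coordinatewise, so each weak-* neighbourhood is
  reached eventually along \<open>K\<close>. As \<open>K\<close> is proper and finer than
  \<open>sequentially\<close>, it is reached frequently along \<open>sequentially\<close>.\<close>

lemma weak_star_accumulation_pointI:
  assumes f: "f \<in> Linf M" and X: "\<And>n. X n \<in> Linf M" and K: "K \<le> sequentially" "K \<noteq> bot"
    and lim: "\<And>\<phi>. \<phi> \<in> L1 M \<Longrightarrow> ((\<lambda>n. LINT s|M. X n s * \<phi> s) \<longlongrightarrow> (LINT s|M. f s * \<phi> s)) K"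
  shows "weak_star_accumulation_point M X f"
  unfolding weak_star_accumulation_point_def
proof (intro conjI allI impI)
  fix V assume V: "openin (weak_star_topology M) V \<and> f \<in> V"
  let ?e = "\<lambda>f. \<lambda>\<phi>\<in>L1 M. LINT s|M. f s * \<phi> s"
  obtain W where W: "openin (product_topology (\<lambda>_. euclideanreal) (L1 M)) W" "V = ?e -` W \<inter> Linf M"
    using V unfolding weak_star_topology_def openin_pullback_topology by blast
  have "limitin (product_topology (\<lambda>_. euclideanreal) (L1 M)) (\<lambda>n. ?e (X n)) (?e f) K"
    unfolding limitin_componentwise using lim by auto
  then have "eventually (\<lambda>n. ?e (X n) \<in> W) K"
    using W V unfolding limitin_def by blast
  then have "eventually (\<lambda>n. X n \<in> V) K" by eventually_elim (use W X in auto)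
  then have "frequently (\<lambda>n. X n \<in> V) K" using K(2) by (rule eventually_frequently[rotated])
  then show "frequently (\<lambda>n. X n \<in> V) sequentially"
    using K(1) unfolding frequently_def le_filter_def by blast
qed (fact f)

text \<open>Closeness to \<open>f\<close> on finitely many test functions defines a basic
  neighbourhood of \<open>f\<close>. All of \<open>S\<close> is handled at once, because
  "frequently" does not distribute over conjunctions.\<close>

lemma weak_star_accumulation_pointD:
  assumes acc: "weak_star_accumulation_point M X f"
    and S: "finite S" "S \<subseteq> L1 M" and \<epsilon>: "0 < \<epsilon>"
  shows "\<exists>\<^sub>F n in sequentially. \<forall>\<phi>\<in>S. \<bar>(LINT s|M. X n s * \<phi> s) - (LINT s|M. f s * \<phi> s)\<bar> < \<epsilon>"
proof -
  let ?e = "\<lambda>f. \<lambda>\<phi>\<in>L1 M. LINT s|M. f s * \<phi> s"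
  let ?B = "\<lambda>\<phi>. if \<phi> \<in> S then ball (LINT s|M. f s * \<phi> s) \<epsilon> else UNIV"
  have "finite {\<phi> \<in> L1 M. ?B \<phi> \<noteq> UNIV}" by (rule finite_subset[OF _ S(1)]) auto
  then have W: "openin (product_topology (\<lambda>_. euclideanreal) (L1 M)) (PiE (L1 M) ?B)"
    unfolding openin_PiE_gen by auto
  define V where "V = ?e -` PiE (L1 M) ?B \<inter> Linf M"
  have "openin (weak_star_topology M) V"
    unfolding V_def weak_star_topology_def openin_pullback_topology using W by blast
  moreover have "f \<in> V" using acc \<epsilon> by (auto simp: V_def weak_star_accumulation_point_def)
  ultimately have "\<exists>\<^sub>F n in sequentially. X n \<in> V"
    using acc by (auto simp: weak_star_accumulation_point_def)
  then show ?thesis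
  proof (rule frequently_elim1)
    fix n assume n: "X n \<in> V"
    show "\<forall>\<phi>\<in>S. \<bar>(LINT s|M. X n s * \<phi> s) - (LINT s|M. f s * \<phi> s)\<bar> < \<epsilon>"
    proof
      fix \<phi> assume \<phi>: "\<phi> \<in> S"
      then have "?e (X n) \<phi> \<in> ?B \<phi>" using n S(2) unfolding V_def by (blast dest: PiE_mem)
      then show "\<bar>(LINT s|M. X n s * \<phi> s) - (LINT s|M. f s * \<phi> s)\<bar> < \<epsilon>"
        using \<phi> S(2) by (auto simp: dist_real_def abs_minus_commute)
    qed
  qed
qed

lemma weak_star_accumulation_point_exists:
  assumes "\<And>n. X n \<in> feasible M"
  shows "\<exists>f. weak_star_accumulation_point M X f"
proof -
  obtain f K where *: "f \<in> feasible M" "K \<le> sequentially" "K \<noteq> bot"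
    "\<And>\<phi>. \<phi> \<in> L1 M \<Longrightarrow> ((\<lambda>n. LINT s|M. X n s * \<phi> s) \<longlongrightarrow> (LINT s|M. f s * \<phi> s)) K"
    using feasible_weak_star_compact[of X sequentially, OF assms sequentially_bot] by blast
  have "weak_star_accumulation_point M X f"
    by (rule weak_star_accumulation_pointI[OF feasible_Linf[OF *(1)] feasible_Linf[OF assms] *(2-4)])
  then show ?thesis by (rule exI[of "weak_star_accumulation_point M X"])
qed

text \<open>The bounds 0 and \<open>measure M A\<close> for pairings with indicators pass to
  \<open>f\<close>; testing with the sets where \<open>f\<close> is negative and where it exceeds 1
  shows that both are null.\<close>

lemma weak_star_accumulation_point_feasible:
  assumes X: "\<And>n. X n \<in> feasible M" and acc: "weak_star_accumulation_point M X f"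
  shows "f \<in> feasible M"
proof -
  have f: "f \<in> Linf M" using acc by (simp add: weak_star_accumulation_point_def)
  then have [measurable]: "f \<in> borel_measurable M" by (simp add: Linf_def)
  have pair: "0 \<le> (LINT s|M. f s * indicator A s)" "(LINT s|M. f s * indicator A s) \<le> measure M A"
    if A: "A \<in> sets M" for A
  proof -
    have near: "\<exists>n. \<bar>(LINT s|M. X n s * indicator A s) - (LINT s|M. f s * indicator A s)\<bar> < \<epsilon>"
      if "0 < \<epsilon>" for \<epsilon>
      using weak_star_accumulation_pointD[OF acc, of "{indicator A}" \<epsilon>] indicator_L1[OF A] that
      by (auto dest: frequently_ex)
    have "- \<epsilon> \<le> (LINT s|M. f s * indicator A s) \<and> (LINT s|M. f s * indicator A s) \<le> measure M A + \<epsilon>"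
      if \<epsilon>: "0 < \<epsilon>" for \<epsilon>
    proof -
      obtain n where "\<bar>(LINT s|M. X n s * indicator A s) - (LINT s|M. f s * indicator A s)\<bar> < \<epsilon>"
        using near[OF \<epsilon>] by blast
      then show ?thesis using feasible_pairing_indicator[OF X A, of n] by linarith
    qed
    then have le: "0 \<le> (LINT s|M. f s * indicator A s) + \<epsilon>"
      "(LINT s|M. f s * indicator A s) \<le> measure M A + \<epsilon>" if "0 < \<epsilon>" for \<epsilon>
      using that by fastforce+
    show "0 \<le> (LINT s|M. f s * indicator A s)" "(LINT s|M. f s * indicator A s) \<le> measure M A"
      by (rule field_le_epsilon, rule le, assumption)+
  qed
  have null: "AE s in M. g s \<le> 0"
    if g: "integrable M g" and le: "(LINT s|M. g s * indicator {s \<in> space M. 0 < g s} s) \<le> 0" for g :: "'a \<Rightarrow> real"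
  proof -
    have [measurable]: "g \<in> borel_measurable M" using g by auto
    let ?A = "{s \<in> space M. 0 < g s}"
    have int: "integrable M (\<lambda>s. g s * indicator ?A s)"
      using integrable_real_mult_indicator[OF _ g, of ?A] by simp
    have nn: "AE s in M. 0 \<le> g s * indicator ?A s" by (auto simp: indicator_def)
    have "AE s in M. g s * indicator ?A s = 0"
      using integral_nonneg_eq_0_iff_AE[OF int nn] integral_nonneg_AE[OF nn] le by simp
    then show ?thesis by (rule AE_mp) (rule AE_I2, auto simp: indicator_def not_less split: if_splits)
  qed
  have fi: "integrable M f" using Linf_imp_L1[OF f] by (simp add: L1_def)
  have "AE s in M. - f s \<le> 0"
    by (rule null) (use fi pair(1)[of "{s \<in> space M. 0 < - f s}"] in auto)
  moreover have "AE s in M. f s - 1 \<le> 0"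
  proof (rule null)
    let ?A = "{s \<in> space M. 0 < f s - 1}"
    have A: "?A \<in> sets M" by measurable
    have "(LINT s|M. (f s - 1) * indicator ?A s) = (LINT s|M. f s * indicator ?A s - indicator ?A s)"
      by (simp add: left_diff_distrib)
    also have "\<dots> = (LINT s|M. f s * indicator ?A s) - (LINT s|M. indicator ?A s)"
      using Linf_mult_L1[OF f indicator_L1[OF A]] indicator_L1[OF A]
      by (intro Bochner_Integration.integral_diff) (auto simp: L1_def)
    also have "(LINT s|M. indicator ?A s) = measure M ?A"
      using sets.sets_into_space[OF A] by (simp add: Int_absorb2)
    finally show "(LINT s|M. (f s - 1) * indicator ?A s) \<le> 0" using pair(2)[OF A] by simp
  qed (use fi in auto)
  ultimately have "AE s in M. 0 \<le> f s \<and> f s \<le> 1" by eventually_elim auto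
  then show ?thesis using Linf_imp_L2[OF f] by (simp add: feasible_def)
qed

text \<open>The subsequence is tested only against the members of \<open>X\<close> and \<open>f\<close>, which avoids separability
  of L1: any cluster point \<open>h\<close> of it then satisfies \<open>\<integral> h h = \<integral> h f = \<integral> f f\<close>, so \<open>h = f\<close> a.e.\<close>

lemma weak_star_accumulation_point_imp_subsequence:
  assumes X: "\<And>n. X n \<in> feasible M" and acc: "weak_star_accumulation_point M X f"
  obtains q :: "nat \<Rightarrow> nat" where "strict_mono q" "L2_weakly_converges M (\<lambda>k. X (q k)) f"
proof -
  have f: "f \<in> feasible M" by (rule weak_star_accumulation_point_feasible[OF X acc])
  \<comment> \<open>Stage \<open>k\<close> tests against \<open>f\<close> and the first
    \<open>k + 1\<close> members of \<open>X\<close>, a finite set as the accumulation property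
    requires; each test enters at some stage and stays.\<close>
  define close where "close k n \<longleftrightarrow> (\<forall>\<phi>\<in>insert f (X ` {..k}).
    \<bar>(LINT s|M. X n s * \<phi> s) - (LINT s|M. f s * \<phi> s)\<bar> < inverse (real (Suc k)))" for k n
  have ex: "\<exists>n>m. close k n" for k m
  proof -
    have "\<exists>\<^sub>F n in sequentially. close k n"
      unfolding close_def
      by (rule weak_star_accumulation_pointD[OF acc]) (use f X feasible_L1 in auto)
    then show ?thesis unfolding frequently_sequentially by (metis Suc_le_lessD)
  qed
  have "\<exists>q. \<forall>k. close k (q k) \<and> q k < q (Suc k)"
    by (rule dependent_nat_choice[of close "\<lambda>_ m n. m < n"]) (use ex in blast)+
  then obtain q where q: "\<And>k. close k (q k)" "strict_mono q"
    by (auto simp: strict_mono_Suc_iff)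
  define Y where "Y k = X (q k)" for k
  have Y: "Y k \<in> feasible M" for k by (simp add: Y_def X)
  have lim: "(\<lambda>k. LINT s|M. Y k s * \<phi> s) \<longlonglongrightarrow> (LINT s|M. f s * \<phi> s)"
    if \<phi>: "\<phi> = f \<or> \<phi> = X j" for \<phi> j
  proof -
    have "\<forall>\<^sub>F k in sequentially. norm ((LINT s|M. Y k s * \<phi> s) - (LINT s|M. f s * \<phi> s)) \<le> inverse (real (Suc k))"
      using eventually_ge_at_top[of j]
    proof eventually_elim
      case (elim k)
      have "\<phi> \<in> insert f (X ` {..k})" using \<phi> elim by auto
      then show ?case using q(1)[of k] unfolding close_def Y_def real_norm_def by (blast intro: less_imp_le)
    qed
    from Lim_null_comparison[OF this LIMSEQ_inverse_real_of_nat] show ?thesis by (simp add: LIM_zero_iff)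
  qed
  have "(\<lambda>k. LINT s|M. Y k s * \<phi> s) \<longlonglongrightarrow> (LINT s|M. f s * \<phi> s)" (is "?a \<longlonglongrightarrow> ?l")
    if \<phi>: "\<phi> \<in> L2 M" for \<phi>
  proof (rule ccontr)
    assume "\<not> ?a \<longlonglongrightarrow> ?l"
    then obtain \<epsilon> where \<epsilon>: "0 < \<epsilon>" "\<not> (\<forall>\<^sub>F k in sequentially. dist (?a k) ?l < \<epsilon>)"
      unfolding tendsto_iff by blast
    \<comment> \<open>Compactness is applied along the indices where the pairing stays
      \<open>\<epsilon>\<close> away from the claimed limit. The cluster point \<open>h\<close> will
      equal \<open>f\<close> a.e., so that the pairing converges to this limit after all.\<close>
    define F where "F = inf sequentially (principal {k. \<not> dist (?a k) ?l < \<epsilon>})"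
    have "F \<noteq> bot"
      using \<epsilon>(2) by (simp add: F_def trivial_limit_def eventually_inf_principal)
    then obtain h K where h: "h \<in> feasible M" and K: "K \<le> F" "K \<noteq> bot"
      and limh: "\<And>\<psi>. \<psi> \<in> L1 M \<Longrightarrow> ((\<lambda>k. LINT s|M. Y k s * \<psi> s) \<longlongrightarrow> (LINT s|M. h s * \<psi> s)) K"
      using feasible_weak_star_compact[of Y F, OF Y] by blast
    have KS: "K \<le> sequentially" using K(1) unfolding F_def by simp
    have eq: "(LINT s|M. h s * \<psi> s) = (LINT s|M. f s * \<psi> s)" if "\<psi> = f \<or> \<psi> = X j" for \<psi> j
      by (rule tendsto_unique[OF K(2) limh tendsto_mono[OF KS lim[OF that]]])
        (use that f X feasible_L1 in auto)
    have "((\<lambda>k. LINT s|M. Y k s * h s) \<longlongrightarrow> (LINT s|M. f s * f s)) K"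
    proof -
      \<comment> \<open>\<open>Y k\<close> is a member of \<open>X\<close>, hence one of the tests
        on which \<open>h\<close> and \<open>f\<close> agree.\<close>
      have "(LINT s|M. Y k s * h s) = (LINT s|M. Y k s * f s)" for k
        using eq[of "Y k" "q k"] by (simp add: Y_def mult.commute)
      then show ?thesis using tendsto_mono[OF KS lim[of f]] by simp
    qed
    then have hh: "(LINT s|M. h s * h s) = (LINT s|M. f s * f s)"
      using tendsto_unique[OF K(2) limh[OF feasible_L1[OF h]]] by blast
    have int: "integrable M (\<lambda>s. h s * h s)" "integrable M (\<lambda>s. h s * f s)" "integrable M (\<lambda>s. f s * f s)"
      using feasible_mult_integrable feasible_L1 f h by auto
    have sq: "(h s - f s)\<^sup>2 = h s * h s - 2 * (h s * f s) + f s * f s" for s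
      by (simp add: power2_eq_square algebra_simps)
    have "(LINT s|M. (h s - f s)\<^sup>2) = 0"
      unfolding sq using int hh eq[of f] by simp
    moreover have "integrable M (\<lambda>s. (h s - f s)\<^sup>2)" unfolding sq using int by simp
    ultimately have "AE s in M. (h s - f s)\<^sup>2 = 0"
      using integral_nonneg_eq_0_iff_AE[of M "\<lambda>s. (h s - f s)\<^sup>2"] by simp
    then have hf: "AE s in M. h s * \<phi> s = f s * \<phi> s" by eventually_elim simp
    have "(LINT s|M. h s * \<phi> s) = ?l"
    proof (rule integral_cong_AE)
      show "(\<lambda>s. h s * \<phi> s) \<in> borel_measurable M" "(\<lambda>s. f s * \<phi> s) \<in> borel_measurable M"
        using feasible_mult_integrable L2_imp_L1[OF \<phi>] f h by auto
    qed (rule hf)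
    then have "\<forall>\<^sub>F k in K. dist (?a k) ?l < \<epsilon>"
      using limh[OF L2_imp_L1[OF \<phi>]] \<epsilon>(1) by (simp add: tendsto_iff)
    moreover have "\<forall>\<^sub>F k in K. \<not> dist (?a k) ?l < \<epsilon>"
      by (rule filter_leD[OF K(1)]) (simp add: F_def eventually_inf_principal)
    ultimately have "\<forall>\<^sub>F k in K. False" by eventually_elim blast
    with K(2) show False by (simp add: trivial_limit_def)
  qed
  then have "L2_weakly_converges M Y f"
    using Y f unfolding L2_weakly_converges_def by (auto simp: feasible_def)
  then show thesis using that[OF q(2)] by (simp add: Y_def[abs_def])
qed

end

section \<open>Criticality and linearisation\<close>

context finite_measure
begin

text \<open>In the closed formula two terms are controlled by the gradient difference, since
  \<open>x\<close> is bounded by 1 and the negative part is nonexpansive. The pairing of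
  \<open>G y\<close> with \<open>x - y\<close> is left unestimated, so that weak convergence of the
  argument can make it small.\<close>

lemma criticality_diff:
  assumes x: "x \<in> feasible M" "G x \<in> Linf M" and y: "y \<in> feasible M" "G y \<in> Linf M"
  shows "\<bar>criticality M G x - criticality M G y\<bar>
    \<le> 2 * L1_norm M (\<lambda>s. G x s - G y s) + \<bar>LINT s|M. G y s * (x s - y s)\<bar>"
proof -
  have crit: "criticality M G z = (LINT s|M. G z s * z s) + (LINT s|M. max (- G z s) 0)"
    if "z \<in> feasible M" "G z \<in> Linf M" for z
    using that by (intro criticality_is_max(3)) (auto simp: feasible_def finite_measure_axioms)
  have d: "(\<lambda>s. G x s - G y s) \<in> L1 M" by (intro Linf_imp_L1 Linf_diff x y)
  have int: "integrable M (\<lambda>s. G x s * x s)" "integrable M (\<lambda>s. G y s * x s)" "integrable M (\<lambda>s. G y s * y s)"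
    using Linf_mult_L1 feasible_L1 x y by auto
  have Gi: "integrable M (G x)" "integrable M (G y)" using x y Linf_imp_L1 by (auto simp: L1_def)
  have "criticality M G x - criticality M G y
      = (LINT s|M. x s * (G x s - G y s)) + (LINT s|M. G y s * (x s - y s))
        + (LINT s|M. max (- G x s) 0 - max (- G y s) 0)"
    unfolding crit[OF x] crit[OF y] using int Gi by (simp add: algebra_simps)
  moreover have "\<bar>LINT s|M. x s * (G x s - G y s)\<bar> \<le> L1_norm M (\<lambda>s. G x s - G y s)"
    by (rule feasible_pairing_bound[OF x(1) d])
  moreover have "\<bar>LINT s|M. max (- G x s) 0 - max (- G y s) 0\<bar> \<le> L1_norm M (\<lambda>s. G x s - G y s)"
  proof -
    have "\<bar>LINT s|M. max (- G x s) 0 - max (- G y s) 0\<bar> \<le> (LINT s|M. \<bar>max (- G x s) 0 - max (- G y s) 0\<bar>)"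
      by (rule integral_abs_bound)
    also have "\<dots> \<le> L1_norm M (\<lambda>s. G x s - G y s)"
      unfolding L1_norm_def by (rule integral_mono) (use Gi in auto)
    finally show ?thesis .
  qed
  ultimately show ?thesis by linarith
qed

lemma criticality_weakly_continuous:
  assumes G: "\<And>x. x \<in> L1 M \<Longrightarrow> G x \<in> Linf M" and wn: "weak_norm_continuous_L2 M G"
    and X: "\<And>n. X n \<in> feasible M" and x: "x \<in> feasible M" and conv: "L2_weakly_converges M X x"
  shows "(\<lambda>n. criticality M G (X n)) \<longlonglongrightarrow> criticality M G x"
proof -
  note GX = G[OF feasible_L1[OF X]] and Gx = G[OF feasible_L1[OF x]]
  let ?N = "\<lambda>n. L2_norm M (\<lambda>s. G (X n) s - G x s)"
  have "?N \<longlonglongrightarrow> 0" using wn conv by (simp add: weak_norm_continuous_L2_def)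
  from tendsto_mult_left_zero[OF this, of "2 * sqrt (measure M (space M))"]
  have 1: "(\<lambda>n. 2 * (?N n * sqrt (measure M (space M)))) \<longlonglongrightarrow> 0" by (simp add: ac_simps)
  have "(\<lambda>n. LINT s|M. X n s * G x s) \<longlonglongrightarrow> (LINT s|M. x s * G x s)"
    using conv Linf_imp_L2[OF Gx] by (simp add: L2_weakly_converges_def)
  then have "(\<lambda>n. (LINT s|M. X n s * G x s) - (LINT s|M. x s * G x s)) \<longlonglongrightarrow> 0"
    by (simp add: LIM_zero)
  moreover have "(LINT s|M. X n s * G x s) - (LINT s|M. x s * G x s) = (LINT s|M. G x s * (X n s - x s))" for n
    using Linf_mult_L1[OF Gx] feasible_L1[OF X] feasible_L1[OF x]
    by (simp add: right_diff_distrib mult.commute[of _ "G x s" for s])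
  ultimately have 2: "(\<lambda>n. \<bar>LINT s|M. G x s * (X n s - x s)\<bar>) \<longlonglongrightarrow> 0"
    by (simp add: tendsto_rabs_zero)
  have "(\<lambda>n. criticality M G (X n) - criticality M G x) \<longlonglongrightarrow> 0"
  proof (rule Lim_null_comparison[OF always_eventually])
    show "(\<lambda>n. 2 * (?N n * sqrt (measure M (space M))) + \<bar>LINT s|M. G x s * (X n s - x s)\<bar>) \<longlonglongrightarrow> 0"
      using tendsto_add[OF 1 2] by simp
    have "L1_norm M (\<lambda>s. G (X n) s - G x s) \<le> ?N n * sqrt (measure M (space M))" for n
      by (intro L1_norm_le_L2_norm Linf_imp_L2 Linf_diff GX Gx)
    then show "\<forall>n. norm (criticality M G (X n) - criticality M G x)
        \<le> 2 * (?N n * sqrt (measure M (space M))) + \<bar>LINT s|M. G x s * (X n s - x s)\<bar>"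
      using criticality_diff[OF X GX x Gx] by (intro allI) (simp, smt (verit))
  qed
  then show ?thesis by (simp add: LIM_zero_iff)
qed

lemma derivative_remainder:
  assumes J: "L1_frechet_differentiable M J" and G: "represents_derivative M J G"
    and x: "x \<in> L1 M" and \<epsilon>: "0 < \<epsilon>"
  obtains \<eta> where "0 < \<eta>" "\<And>h. h \<in> L1 M \<Longrightarrow> L1_norm M h < \<eta> \<Longrightarrow>
    \<bar>J (\<lambda>s. x s + h s) - J x - (LINT s|M. G x s * h s)\<bar> \<le> \<epsilon> * L1_norm M h"
proof -
  obtain A where A: "has_L1_frechet_derivative M J A x"
    using J x by (auto simp: L1_frechet_differentiable_def)
  then have "A h = (LINT s|M. G x s * h s)" if "h \<in> L1 M" for h
    using G x that by (auto simp: represents_derivative_def)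
  moreover obtain \<eta> where "0 < \<eta>"
    "\<And>h. h \<in> L1 M \<Longrightarrow> L1_norm M h < \<eta> \<Longrightarrow> \<bar>J (\<lambda>s. x s + h s) - J x - A h\<bar> \<le> \<epsilon> * L1_norm M h"
    using A \<epsilon> unfolding has_L1_frechet_derivative_def by blast
  ultimately show thesis using that[of \<eta>] by simp
qed

text \<open>Difference quotients along a line are Frechet remainders with increments
  \<open>u * h\<close>; this makes the mean value theorem available.\<close>

lemma derivative_along_line:
  assumes J: "L1_frechet_differentiable M J" and G: "represents_derivative M J G"
    and x: "x \<in> L1 M" and h: "h \<in> L1 M"
  shows "((\<lambda>t. J (\<lambda>s. x s + t * h s)) has_real_derivative
    (LINT s|M. G (\<lambda>s. x s + t * h s) s * h s)) (at t)"
  unfolding DERIV_def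
proof (rule LIM_I)
  fix r :: real assume r: "0 < r"
  let ?x = "\<lambda>s. x s + t * h s" and ?n = "L1_norm M h"
  have n: "0 \<le> ?n" by (simp add: L1_norm_def)
  have xt: "?x \<in> L1 M" using x h by (auto simp: L1_def)
  \<comment> \<open>The \<open>+ 1\<close> allows \<open>h\<close> to be null and makes the final
    inequality strict.\<close>
  obtain \<eta> where \<eta>: "0 < \<eta>" "\<And>k. k \<in> L1 M \<Longrightarrow> L1_norm M k < \<eta> \<Longrightarrow>
    \<bar>J (\<lambda>s. ?x s + k s) - J ?x - (LINT s|M. G ?x s * k s)\<bar> \<le> r / (?n + 1) * L1_norm M k"
    by (rule derivative_remainder[OF J G xt, of "r / (?n + 1)"]) (use r n in auto)
  show "\<exists>e>0. \<forall>u. u \<noteq> 0 \<and> norm (u - 0) < e \<longrightarrow>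
    norm ((J (\<lambda>s. x s + (t + u) * h s) - J ?x) / u - (LINT s|M. G ?x s * h s)) < r"
  proof (intro exI[of _ "\<eta> / (?n + 1)"] conjI allI impI)
    show "0 < \<eta> / (?n + 1)" using \<eta>(1) n by simp
    fix u :: real assume u: "u \<noteq> 0 \<and> norm (u - 0) < \<eta> / (?n + 1)"
    have un: "L1_norm M (\<lambda>s. u * h s) = \<bar>u\<bar> * ?n" by (simp add: L1_norm_def abs_mult)
    have "\<bar>u\<bar> * (?n + 1) < \<eta>" using u n by (simp add: field_simps)
    moreover have "\<bar>u\<bar> * ?n \<le> \<bar>u\<bar> * (?n + 1)" by (intro mult_left_mono) auto
    ultimately have "L1_norm M (\<lambda>s. u * h s) < \<eta>" unfolding un by linarith
    from \<eta>(2)[OF _ this]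
    have "\<bar>J (\<lambda>s. ?x s + u * h s) - J ?x - (LINT s|M. G ?x s * (u * h s))\<bar> \<le> r / (?n + 1) * (\<bar>u\<bar> * ?n)"
      using h by (simp add: L1_def un)
    moreover have "(\<lambda>s. ?x s + u * h s) = (\<lambda>s. x s + (t + u) * h s)" by (simp add: algebra_simps)
    moreover have "(LINT s|M. G ?x s * (u * h s)) = u * (LINT s|M. G ?x s * h s)"
      by (simp add: mult.left_commute)
    ultimately have le: "\<bar>J (\<lambda>s. x s + (t + u) * h s) - J ?x - u * (LINT s|M. G ?x s * h s)\<bar>
      \<le> r / (?n + 1) * (\<bar>u\<bar> * ?n)" by simp
    have lt: "r / (?n + 1) * (\<bar>u\<bar> * ?n) < \<bar>u\<bar> * r"
      using u r n by (simp add: field_simps)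
    have eq: "J (\<lambda>s. x s + (t + u) * h s) - J ?x - u * (LINT s|M. G ?x s * h s)
        = u * ((J (\<lambda>s. x s + (t + u) * h s) - J ?x) / u - (LINT s|M. G ?x s * h s))"
      using conjunct1[OF u] by (simp add: right_diff_distrib diff_divide_distrib)
    have "\<bar>u\<bar> * \<bar>(J (\<lambda>s. x s + (t + u) * h s) - J ?x) / u - (LINT s|M. G ?x s * h s)\<bar> < \<bar>u\<bar> * r"
      using order_le_less_trans[OF le lt] unfolding eq abs_mult .
    then show "norm ((J (\<lambda>s. x s + (t + u) * h s) - J ?x) / u - (LINT s|M. G ?x s * h s)) < r"
      using u by simp
  qed
qed

text \<open>Mean value theorem on the segment from \<open>x\<close> to \<open>x + h\<close>, then
  Cauchy-Schwarz for the gradient difference. For a step that changes a set of measure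
  \<open>d\<close> the bound is \<open>L * d * sqrt d\<close>, of higher than first order and
  uniform in \<open>x\<close>.\<close>

lemma lipschitz_remainder:
  assumes J: "L1_frechet_differentiable M J" and G: "represents_derivative M J G"
    and L: "0 \<le> L" "\<And>x y. x \<in> L1 M \<Longrightarrow> y \<in> L1 M \<Longrightarrow>
      L2_norm M (\<lambda>s. G x s - G y s) \<le> L * L1_norm M (\<lambda>s. x s - y s)"
    and x: "x \<in> L1 M" and h: "h \<in> L2 M"
  shows "\<bar>J (\<lambda>s. x s + h s) - J x - (LINT s|M. G x s * h s)\<bar> \<le> L * L1_norm M h * L2_norm M h"
proof -
  note h1 = L2_imp_L1[OF h]
  obtain t where t: "0 < t" "t < 1"
    "J (\<lambda>s. x s + 1 * h s) - J (\<lambda>s. x s + 0 * h s) = (1 - 0) * (LINT s|M. G (\<lambda>s. x s + t * h s) s * h s)"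
    using MVT2[of 0 1, OF _ derivative_along_line[OF J G x h1]] by auto
  let ?y = "\<lambda>s. x s + t * h s"
  have y: "?y \<in> L1 M" using x h1 by (auto simp: L1_def)
  have GL: "G x \<in> Linf M" "G ?y \<in> Linf M" using G x y by (auto simp: represents_derivative_def)
  have "J (\<lambda>s. x s + h s) - J x - (LINT s|M. G x s * h s) = (LINT s|M. G ?y s * h s) - (LINT s|M. G x s * h s)"
    using t(3) by simp
  also have "\<dots> = (LINT s|M. (G ?y s - G x s) * h s)"
    using Linf_mult_L1[OF GL(1) h1] Linf_mult_L1[OF GL(2) h1] by (simp add: left_diff_distrib)
  finally have "\<bar>J (\<lambda>s. x s + h s) - J x - (LINT s|M. G x s * h s)\<bar> \<le> L1_norm M (\<lambda>s. (G ?y s - G x s) * h s)"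
    unfolding L1_norm_def by (metis integral_abs_bound)
  also have "\<dots> \<le> L2_norm M (\<lambda>s. G ?y s - G x s) * L2_norm M h"
    by (intro Cauchy_Schwarz_L2 h Linf_imp_L2 Linf_diff GL)
  also have "\<dots> \<le> (L * L1_norm M h) * L2_norm M h"
  proof (rule mult_right_mono)
    have "L2_norm M (\<lambda>s. G ?y s - G x s) \<le> L * L1_norm M (\<lambda>s. ?y s - x s)" by (rule L(2)[OF y x])
    also have "L1_norm M (\<lambda>s. ?y s - x s) = t * L1_norm M h"
      using t by (simp add: L1_norm_def abs_mult)
    also have "L * (t * L1_norm M h) \<le> L * L1_norm M h"
      using t L(1) by (intro mult_left_mono mult_left_le_one_le) (auto simp: L1_norm_def)
    finally show "L2_norm M (\<lambda>s. G ?y s - G x s) \<le> L * L1_norm M h" .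
  qed (simp add: L2_norm_def)
  finally show ?thesis .
qed

end

section \<open>Runs of the algorithm\<close>

text \<open>Lebesgue measure on the domain is abstracted to a finite divisible measure. The bound on
  \<open>\<Delta>max\<close> keeps the radii within the total measure, as
  \<open>best_fraction\<close> requires.\<close>

locale btr = finite_measure M for M :: "'a measure" +
  fixes J :: "('a \<Rightarrow> real) \<Rightarrow> real"
    and G :: "('a \<Rightarrow> real) \<Rightarrow> 'a \<Rightarrow> real"
    and \<Delta>max \<sigma>1 \<sigma>2 \<omega> :: real
    and U D :: "nat \<Rightarrow> 'a set"
    and \<Delta> :: "nat \<Rightarrow> real"
  assumes divisible: "divisible M"
    and bounded_below: "bounded_below_on_L2 M J"
    and differentiable: "L1_frechet_differentiable M J"
    and gradient: "represents_derivative M J G"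
    and \<Delta>max: "\<Delta>max < measure M (space M)"
    and \<sigma>: "0 < \<sigma>1" "\<sigma>1 < 1"
    and run: "BTR_run M J G \<Delta>max \<sigma>1 \<sigma>2 \<omega> U D \<Delta>"
begin

definition g where "g n = signed_gradient M G (U n)"
definition crit where "crit n = criticality M G (indicator (U n))"
definition predicted where "predicted n = predicted_change M G (U n) (D n)"
definition actual where "actual n = actual_change J (U n) (D n)"
definition accepted where "accepted n \<longleftrightarrow> actual n \<le> \<sigma>1 * predicted n"
definition obj where "obj n = J (indicator (U n))"
definition vol where "vol = measure M (space M)"
text \<open>The increment that turns the indicator of \<open>U n\<close> into that of the trial set
  \<open>sym_diff (U n) (D n)\<close>; it is the direction of the linearisation.\<close>

definition step :: "nat \<Rightarrow> 'a \<Rightarrow> real"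
  where "step n s = indicator (D n - U n) s - indicator (U n \<inter> D n) s"

section \<open>Measurability of the iterates and bounds on the radii\<close>

lemma find_step_D: "find_step M (g n) (\<Delta> n) (step_tolerance M (g n) \<omega> (\<Delta> n)) (D n)"
  using run by (simp add: BTR_run_def Let_def g_def)

lemma accepted_step:
  assumes "accepted n"
  shows "U (Suc n) = sym_diff (U n) (D n)" "\<Delta> (Suc n) = \<Delta> n \<or> \<Delta> (Suc n) = min (2 * \<Delta> n) \<Delta>max"
  using run assms by (auto simp: BTR_run_def Let_def accepted_def actual_def predicted_def)

lemma rejected_step:
  assumes "\<not> accepted n"
  shows "U (Suc n) = U n" "\<Delta> (Suc n) = \<Delta> n / 2"
  using run assms by (auto simp: BTR_run_def Let_def accepted_def actual_def predicted_def)

lemma D_sets: "D n \<in> sets M" and D_le: "measure M (D n) \<le> \<Delta> n"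
  using find_step_D[of n] by (auto simp: find_step_def step_candidates_def)

lemma U_sets: "U n \<in> sets M"
proof (induction n)
  case 0
  show ?case using run by (simp add: BTR_run_def)
next
  case (Suc n)
  then show ?case using accepted_step(1)[of n] rejected_step(1)[of n] D_sets[of n] by (cases "accepted n") auto
qed

lemma \<Delta>_bounds: "0 < \<Delta> n \<and> \<Delta> n \<le> \<Delta>max"
proof (induction n)
  case 0
  show ?case using run by (simp add: BTR_run_def)
next
  case (Suc n)
  then show ?case using accepted_step(2)[of n] rejected_step(2)[of n] by (cases "accepted n") auto
qed

lemma vol_pos: "0 < vol" and \<Delta>_le_vol: "\<Delta> n \<le> vol"
  using \<Delta>_bounds[of 0] \<Delta>_bounds[of n] \<Delta>max by (auto simp: vol_def)

lemma ind_feasible: "indicator (U n) \<in> feasible M"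
  by (rule indicator_feasible[OF U_sets])

lemma grad_Linf: "x \<in> L1 M \<Longrightarrow> G x \<in> Linf M"
  using gradient by (simp add: represents_derivative_def)

lemma grad_U_Linf: "G (indicator (U n)) \<in> Linf M"
  by (rule grad_Linf[OF indicator_L1[OF U_sets]])

section \<open>Criticality and predicted decrease\<close>

lemma g_integrable: "integrable M (g n)"
proof -
  have "(\<lambda>s. indicator (space M - U n) s - indicator (U n) s :: real) \<in> L1 M"
    using indicator_L1[of "space M - U n"] indicator_L1[OF U_sets[of n]] U_sets[of n] by (simp add: L1_def)
  from Linf_mult_L1[OF grad_U_Linf this] show ?thesis
    by (simp add: g_def signed_gradient_def[abs_def])
qed

text \<open>The integrands agree pointwise: on \<open>U n\<close> the gradient changes sign in
  \<open>g n\<close>, and the gradient plus its negative part is its positive part; outside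
  \<open>U n\<close> both reduce to the negative part.\<close>

lemma crit_eq: "crit n = (LINT s|M. max (- g n s) 0)"
proof -
  let ?G = "G (indicator (U n))"
  have int: "integrable M (\<lambda>s. ?G s * indicator (U n) s)" "integrable M ?G"
    using Linf_mult_L1[OF grad_U_Linf indicator_L1[OF U_sets]] Linf_imp_L1[OF grad_U_Linf]
    by (auto simp: L1_def)
  have "crit n = (LINT s|M. ?G s * indicator (U n) s) + (LINT s|M. max (- ?G s) 0)"
    unfolding crit_def using ind_feasible grad_U_Linf
    by (intro criticality_is_max(3)) (auto simp: feasible_def finite_measure_axioms)
  also have "\<dots> = (LINT s|M. ?G s * indicator (U n) s + max (- ?G s) 0)"
    using int by simp
  also have "\<dots> = (LINT s|M. max (- g n s) 0)"
    by (rule Bochner_Integration.integral_cong)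
      (auto simp: g_def signed_gradient_def indicator_def)
  finally show ?thesis .
qed

lemma crit_nonneg: "0 \<le> crit n"
  unfolding crit_eq by (rule Bochner_Integration.integral_nonneg) simp

lemma predicted_eq: "predicted n = (LINT s:D n|M. g n s)"
  unfolding predicted_def predicted_change_def set_lebesgue_integral_def
  by (rule Bochner_Integration.integral_cong)
    (auto simp: g_def signed_gradient_def indicator_def)

text \<open>The factor 2 is lost to the tolerance of the step, which is at most half the guaranteed gain.\<close>

lemma predicted_le: "predicted n \<le> - (crit n * \<Delta> n / (2 * vol))"
proof -
  let ?h = "\<lambda>s. max (- g n s) 0"
  have gi: "integrable M (g n)" by (rule g_integrable)
  then obtain E where E: "E \<in> sets M" "measure M E \<le> \<Delta> n" "\<forall>s\<in>E. 0 < ?h s"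
    "\<Delta> n * (LINT s|M. ?h s) \<le> measure M (space M) * (LINT s:E|M. ?h s)"
    using best_fraction[OF divisible, of ?h "\<Delta> n"] \<Delta>_bounds[of n] \<Delta>_le_vol[of n]
    by (auto simp: vol_def)
  have cand: "E \<in> step_candidates M (g n) (\<Delta> n)"
  proof -
    have "AE s in M. s \<in> E \<longrightarrow> g n s \<le> 0"
    proof (rule AE_I2, rule impI)
      fix s assume "s \<in> E"
      then have "0 < ?h s" using E(3) by blast
      then show "g n s \<le> 0" by (simp split: if_splits add: max_def)
    qed
    then show ?thesis using E by (simp add: step_candidates_def)
  qed
  \<comment> \<open>A real infimum is a lower bound only of a family bounded below; minus the L1
    norm of \<open>g n\<close> is such a bound.\<close>
  have bdd: "bdd_below ((\<lambda>D'. LINT s:D'|M. g n s) ` step_candidates M (g n) (\<Delta> n))"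
  proof (rule bdd_belowI2)
    fix B assume "B \<in> step_candidates M (g n) (\<Delta> n)"
    then have B: "B \<in> sets M" by (simp add: step_candidates_def)
    have "(LINT s|M. - \<bar>g n s\<bar>) \<le> (LINT s:B|M. g n s)"
      unfolding set_lebesgue_integral_def
    proof (rule integral_mono)
      show "integrable M (\<lambda>s. indicator B s *\<^sub>R g n s)"
        by (rule integrable_mult_indicator[OF B gi])
    qed (use gi in \<open>auto simp: indicator_def\<close>)
    then show "(LINT s|M. - \<bar>g n s\<bar>) \<le> (LINT s:B|M. g n s)" .
  qed
  have "(LINT s:E|M. g n s) = (LINT s:E|M. - ?h s)"
    unfolding set_lebesgue_integral_def
    by (rule Bochner_Integration.integral_cong) (use E(3) in \<open>auto simp: indicator_def max_def split: if_splits\<close>)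
  also have "\<dots> = - (LINT s:E|M. ?h s)"
    by (simp add: set_lebesgue_integral_def)
  also have "\<dots> \<le> - (crit n * \<Delta> n / vol)"
    using E(4) vol_pos by (simp add: crit_eq vol_def[symmetric] field_simps)
  finally have "(INF D'\<in>step_candidates M (g n) (\<Delta> n). LINT s:D'|M. g n s) \<le> - (crit n * \<Delta> n / vol)"
    using cINF_lower[OF bdd cand] by linarith
  moreover have "step_tolerance M (g n) \<omega> (\<Delta> n) * \<Delta> n \<le> (crit n / (2 * vol)) * \<Delta> n"
  proof (rule mult_right_mono)
    have "L1_norm M (\<lambda>s. min (g n s) 0) = crit n"
      unfolding L1_norm_def crit_eq by (rule Bochner_Integration.integral_cong) auto
    then have "step_tolerance M (g n) \<omega> (\<Delta> n) = Min {\<omega>, crit n / (2 * vol), \<Delta> n}"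
      by (simp add: step_tolerance_def vol_def)
    then show "step_tolerance M (g n) \<omega> (\<Delta> n) \<le> crit n / (2 * vol)" by simp
  qed (use \<Delta>_bounds[of n] in auto)
  moreover have "predicted n \<le> (INF D'\<in>step_candidates M (g n) (\<Delta> n). LINT s:D'|M. g n s)
      + step_tolerance M (g n) \<omega> (\<Delta> n) * \<Delta> n"
    using find_step_D[of n] by (simp add: find_step_def predicted_eq)
  ultimately have "predicted n \<le> - (crit n * \<Delta> n / vol) + (crit n / (2 * vol)) * \<Delta> n" by linarith
  then show ?thesis using vol_pos by (simp add: field_simps)
qed

section \<open>Monotonicity and convergence of the objective values\<close>

lemma obj_decrease_accepted:
  assumes "accepted n" shows "\<sigma>1 * (crit n * \<Delta> n / (2 * vol)) \<le> obj n - obj (Suc n)"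
proof -
  have "obj (Suc n) - obj n = actual n"
    using accepted_step(1)[OF assms] by (simp add: obj_def actual_def actual_change_def)
  also have "\<dots> \<le> \<sigma>1 * predicted n" using assms by (simp add: accepted_def)
  also have "\<dots> \<le> \<sigma>1 * - (crit n * \<Delta> n / (2 * vol))"
    using \<sigma> predicted_le[of n] by (intro mult_left_mono) auto
  finally show ?thesis by simp
qed

lemma obj_decreasing: "obj (Suc n) \<le> obj n"
proof (cases "accepted n")
  case True
  have "0 \<le> \<sigma>1 * (crit n * \<Delta> n / (2 * vol))"
    using \<sigma> crit_nonneg[of n] \<Delta>_bounds[of n] vol_pos by simp
  then show ?thesis using obj_decrease_accepted[OF True] by linarith
next
  case False
  then show ?thesis by (simp add: obj_def rejected_step)
qed

lemma decseq_obj: "decseq obj"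
  by (rule decseq_SucI) (rule obj_decreasing)

lemma obj_convergent: "convergent obj"
proof -
  obtain b where "\<forall>x\<in>L2 M. b \<le> J x" using bounded_below by (auto simp: bounded_below_on_L2_def)
  then have "\<forall>n. b \<le> obj n" using ind_feasible by (auto simp: obj_def feasible_def)
  then obtain l where "obj \<longlonglongrightarrow> l" using decseq_convergent[OF decseq_obj, of b] by blast
  then show ?thesis by (rule convergentI)
qed

text \<open>Cauchy form of the convergence: the total decrease over any late stretch of iterations
  is small, not only that of a single step.\<close>

lemma obj_small_decrease:
  assumes "0 < \<epsilon>" obtains N where "\<And>m n. N \<le> m \<Longrightarrow> N \<le> n \<Longrightarrow> obj m - obj n < \<epsilon>"
proof -
  have "Cauchy obj" using obj_convergent by (rule convergent_Cauchy)
  then obtain N where "\<And>m n. N \<le> m \<Longrightarrow> N \<le> n \<Longrightarrow> dist (obj m) (obj n) < \<epsilon>"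
    using assms unfolding Cauchy_def by blast
  then show thesis using that[of N] by (fastforce simp: dist_real_def)
qed

lemma not_eventually_rejected_bounded:
  assumes rej: "\<And>n. n \<ge> N \<Longrightarrow> \<not> accepted n" and m: "0 < m"
  shows "\<exists>n\<ge>N. \<Delta> n < m"
proof -
  have "\<Delta> (N + k) = \<Delta> N * (1 / 2) ^ k" for k
    by (induction k) (use rejected_step(2) rej in auto)
  moreover have "(\<lambda>k. \<Delta> N * (1 / 2) ^ k) \<longlonglongrightarrow> 0"
    by (intro tendsto_mult_right_zero LIMSEQ_power_zero) simp
  ultimately have "(\<lambda>k. \<Delta> (N + k)) \<longlonglongrightarrow> 0" by simp
  from order_tendstoD(2)[OF this m] have "\<forall>\<^sub>F k in sequentially. \<Delta> (N + k) < m" .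
  then obtain k where "\<Delta> (N + k) < m" by (auto simp: eventually_sequentially)
  then show ?thesis by (intro exI[of _ "N + k"]) simp
qed

section \<open>Linearisation error and acceptance of steps\<close>

lemma step_abs: "\<bar>step n s\<bar> = indicator (D n) s"
  by (auto simp: step_def indicator_def)

lemma step_Linf: "step n \<in> Linf M"
proof -
  have "step n = (\<lambda>s. indicator (D n - U n) s - indicator (U n \<inter> D n) s)" by (auto simp: step_def)
  then show ?thesis
    using Linf_diff[OF feasible_Linf[OF indicator_feasible] feasible_Linf[OF indicator_feasible], of "D n - U n" "U n \<inter> D n"]
      U_sets[of n] D_sets[of n] by simp
qed

lemma step_norm: "L1_norm M (step n) = measure M (D n)" "L2_norm M (step n) = sqrt (measure M (D n))"
proof -
  note Dn = sets.Int_space_eq2[OF D_sets[of n]]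
  show "L1_norm M (step n) = measure M (D n)" by (simp add: L1_norm_def step_abs Dn)
  have "(step n s)\<^sup>2 = indicator (D n) s" for s
    by (auto simp: step_def indicator_def)
  then show "L2_norm M (step n) = sqrt (measure M (D n))" by (simp add: L2_norm_def Dn)
qed

lemma actual_minus_predicted:
  "actual n - predicted n = J (\<lambda>s. indicator (U n) s + step n s) - J (indicator (U n))
    - (LINT s|M. G (indicator (U n)) s * step n s)"
proof -
  have "(indicator (sym_diff (U n) (D n)) :: 'a \<Rightarrow> real) = (\<lambda>s. indicator (U n) s + step n s)"
    by (auto simp: step_def indicator_def fun_eq_iff)
  then show ?thesis
    by (simp add: actual_def actual_change_def predicted_def predicted_change_def step_def)
qed

text \<open>\<open>predicted n\<close> is at most minus the guaranteed decrease, so a linearisation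
  error within the share \<open>1 - \<sigma>1\<close> of that decrease keeps the actual change at
  most \<open>\<sigma>1 * predicted n\<close>.\<close>

lemma acceptedI:
  assumes "actual n - predicted n \<le> (1 - \<sigma>1) * (crit n * \<Delta> n / (2 * vol))"
  shows "accepted n"
proof -
  have "(1 - \<sigma>1) * (crit n * \<Delta> n / (2 * vol)) \<le> (1 - \<sigma>1) * - predicted n"
    using predicted_le[of n] \<sigma> by (intro mult_left_mono) auto
  then show ?thesis using assms unfolding accepted_def by (simp add: algebra_simps)
qed

text \<open>If \<open>crit N\<close> were positive, an accepted step would have a null
  \<open>D n\<close> and thus predicted change 0, against \<open>predicted_le\<close>. So all later
  steps are rejected, the iterate stays literally the same set, the radii tend to 0, and
  differentiability at this one point forces an acceptance.\<close>

lemma eventually_constant_critical: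
  assumes const: "\<And>n. n \<ge> N \<Longrightarrow> measure M (sym_diff (U N) (U n)) = 0"
  shows "crit N = 0"
proof (rule ccontr)
  assume "crit N \<noteq> 0"
  then have C: "0 < crit N" using crit_nonneg[of N] by simp
  have same: "U n = U N \<and> \<not> accepted n" if "n \<ge> N" for n
    using that
  proof (induction n rule: dec_induct)
    have rej: "\<not> accepted n" if n: "n \<ge> N" "U n = U N" for n
    proof
      assume acc: "accepted n"
      have "sym_diff (U N) (U (Suc n)) = D n" using accepted_step(1)[OF acc] n(2) by auto
      then have "measure M (D n) = 0" using const[of "Suc n"] n(1) by simp
      then have "D n \<in> null_sets M" using D_sets[of n] by (simp add: null_sets_def emeasure_eq_measure)
      then have "AE s in M. s \<notin> D n" by (rule AE_not_in)
      then have "AE s in M. indicator (D n) s *\<^sub>R g n s = 0" by eventually_elim simp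
      then have "predicted n = 0"
        unfolding predicted_eq set_lebesgue_integral_def by (rule integral_eq_zero_AE)
      moreover have "crit n = crit N" by (simp add: crit_def n)
      then have "0 < crit n * \<Delta> n / (2 * vol)" using C \<Delta>_bounds[of n] vol_pos by simp
      ultimately show False using predicted_le[of n] by linarith
    qed
    case base
    show ?case using rej by simp
    case (step n)
    then have "U (Suc n) = U N" using rejected_step(1)[of n] by simp
    then show ?case using rej[of "Suc n"] step by simp
  qed
  \<comment> \<open>With this choice \<open>\<epsilon> * \<Delta> n\<close> is exactly the error
    allowed by \<open>acceptedI\<close>.\<close>
  define \<epsilon> where "\<epsilon> = (1 - \<sigma>1) * (crit N / (2 * vol))"
  have \<epsilon>: "0 < \<epsilon>" using C \<sigma> vol_pos by (simp add: \<epsilon>_def)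
  obtain \<eta> where \<eta>: "0 < \<eta>" "\<And>h. h \<in> L1 M \<Longrightarrow> L1_norm M h < \<eta> \<Longrightarrow>
    \<bar>J (\<lambda>s. indicator (U N) s + h s) - J (indicator (U N)) - (LINT s|M. G (indicator (U N)) s * h s)\<bar> \<le> \<epsilon> * L1_norm M h"
    using derivative_remainder[OF differentiable gradient indicator_L1[OF U_sets] \<epsilon>] by blast
  obtain n where n: "n \<ge> N" "\<Delta> n < \<eta>"
    using not_eventually_rejected_bounded[of N, OF _ \<eta>(1)] same by blast
  have "accepted n"
  proof (rule acceptedI)
    have Un: "U n = U N" and cn: "crit n = crit N" using same[OF n(1)] by (auto simp: crit_def)
    have "actual n - predicted n \<le> \<epsilon> * measure M (D n)"
      using \<eta>(2)[OF Linf_imp_L1[OF step_Linf], of n] D_le[of n] n(2)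
      unfolding actual_minus_predicted Un step_norm by linarith
    also have "\<dots> \<le> \<epsilon> * \<Delta> n" using D_le[of n] \<epsilon> by (intro mult_left_mono) auto
    also have "\<dots> = (1 - \<sigma>1) * (crit n * \<Delta> n / (2 * vol))" by (simp add: \<epsilon>_def cn)
    finally show "actual n - predicted n \<le> (1 - \<sigma>1) * (crit n * \<Delta> n / (2 * vol))" .
  qed
  then show False using same[OF n(1)] by blast
qed

section \<open>Convergence of the criticality for a Lipschitz gradient\<close>

context
  fixes L :: real
  assumes L: "0 \<le> L" "\<And>x y. x \<in> L1 M \<Longrightarrow> y \<in> L1 M \<Longrightarrow>
    L2_norm M (\<lambda>s. G x s - G y s) \<le> L * L1_norm M (\<lambda>s. x s - y s)"
begin

text \<open>The linearisation error is at most \<open>L * \<Delta> n * sqrt (\<Delta> n)\<close>,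
  while the guaranteed decrease is linear in \<open>\<Delta> n\<close>; the assumption compares the
  two after division by \<open>\<Delta> n\<close>.\<close>

lemma small_radius_accepted:
  assumes "2 * vol * L * sqrt (\<Delta> n) \<le> (1 - \<sigma>1) * crit n"
  shows "accepted n"
proof (rule acceptedI)
  have D0: "0 \<le> measure M (D n)" by simp
  have "actual n - predicted n \<le> L * measure M (D n) * sqrt (measure M (D n))"
    using lipschitz_remainder[OF differentiable gradient L indicator_L1[OF U_sets] Linf_imp_L2[OF step_Linf], of n n]
    unfolding actual_minus_predicted step_norm by linarith
  also have "\<dots> \<le> L * \<Delta> n * sqrt (\<Delta> n)"
    using D_le[of n] \<Delta>_bounds[of n] L(1) by (intro mult_mono real_sqrt_le_mono) auto
  also have "\<dots> = (2 * vol * L * sqrt (\<Delta> n)) * \<Delta> n / (2 * vol)"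
    using vol_pos by (simp add: field_simps)
  also have "\<dots> \<le> ((1 - \<sigma>1) * crit n) * \<Delta> n / (2 * vol)"
    using assms \<Delta>_bounds[of n] vol_pos by (intro divide_right_mono mult_right_mono) auto
  finally show "actual n - predicted n \<le> (1 - \<sigma>1) * (crit n * \<Delta> n / (2 * vol))"
    by (simp add: mult.assoc)
qed

text \<open>While the criticality is at least \<open>\<epsilon>\<close>, all radii up to a fixed
  \<open>\<theta>\<close> are accepted, so the radius stays above a positive \<open>m\<close> and
  each accepted step lowers the objective by a fixed amount. Hence late steps are all rejected,
  which drives the radius below \<open>m\<close>.\<close>

lemma crit_frequently_small:
  assumes \<epsilon>: "0 < \<epsilon>" shows "\<exists>n\<ge>N. crit n < \<epsilon>"
proof (rule ccontr)
  assume "\<not> ?thesis"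
  then have large: "\<epsilon> \<le> crit n" if "n \<ge> N" for n using that by force
  \<comment> \<open>The condition of \<open>small_radius_accepted\<close> solved for the radius,
    with \<open>\<epsilon>\<close> in place of \<open>crit n\<close>; \<open>L + 1\<close> avoids
    division by 0.\<close>
  define \<theta> where "\<theta> = ((1 - \<sigma>1) * \<epsilon> / (2 * vol * (L + 1)))\<^sup>2"
  have \<theta>: "0 < \<theta>" using \<sigma> \<epsilon> vol_pos L(1) by (simp add: \<theta>_def)
  have acc: "accepted n" if n: "n \<ge> N" "\<Delta> n \<le> \<theta>" for n
  proof (rule small_radius_accepted)
    have "0 \<le> (1 - \<sigma>1) * \<epsilon> / (2 * vol * (L + 1))" using \<sigma> \<epsilon> vol_pos L(1) by simp
    then have sq: "sqrt (\<Delta> n) \<le> (1 - \<sigma>1) * \<epsilon> / (2 * vol * (L + 1))"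
      using n(2) unfolding \<theta>_def by (simp add: real_le_lsqrt)
    have "2 * vol * L * sqrt (\<Delta> n) \<le> 2 * vol * (L + 1) * sqrt (\<Delta> n)"
      using vol_pos \<Delta>_bounds[of n] by (intro mult_right_mono) auto
    also have "\<dots> = sqrt (\<Delta> n) * (2 * vol * (L + 1))" by (rule mult.commute)
    also have "\<dots> \<le> (1 - \<sigma>1) * \<epsilon>"
    proof -
      have "0 < 2 * vol * (L + 1)" using vol_pos L(1) by simp
      then show ?thesis using sq by (simp only: pos_le_divide_eq)
    qed
    also have "\<dots> \<le> (1 - \<sigma>1) * crit n" using large[OF n(1)] \<sigma> by (intro mult_left_mono) auto
    finally show "2 * vol * L * sqrt (\<Delta> n) \<le> (1 - \<sigma>1) * crit n" .
  qed
  \<comment> \<open>Only radii above \<open>\<theta>\<close> are halved, so a rejection leaves more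
    than \<open>\<theta> / 2\<close>; acceptance never shrinks the radius.\<close>
  define m where "m = min (\<Delta> N) (\<theta> / 2)"
  have m: "0 < m" using \<theta> \<Delta>_bounds[of N] by (simp add: m_def)
  have radius: "m \<le> \<Delta> n" if "n \<ge> N" for n
    using that
  proof (induction n rule: dec_induct)
    case base
    show ?case by (simp add: m_def)
  next
    case (step n)
    show ?case
    proof (cases "accepted n")
      case True
      then have "\<Delta> n \<le> \<Delta> (Suc n)" using accepted_step(2)[of n] \<Delta>_bounds[of n] by auto
      then show ?thesis using step by simp
    next
      case False
      then have "\<theta> < \<Delta> n" using acc[of n] step by force
      then show ?thesis using rejected_step(2)[OF False] by (simp add: m_def)
    qed
  qed
  define \<delta> where "\<delta> = \<sigma>1 * (\<epsilon> * m / (2 * vol))"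
  have \<delta>: "0 < \<delta>" using \<sigma> \<epsilon> m vol_pos by (simp add: \<delta>_def)
  obtain N' where N': "\<And>i j. N' \<le> i \<Longrightarrow> N' \<le> j \<Longrightarrow> obj i - obj j < \<delta>"
    using obj_small_decrease[OF \<delta>] by blast
  have "\<not> accepted n" if n: "n \<ge> max N N'" for n
  proof
    assume "accepted n"
    have "\<epsilon> * m \<le> crit n * \<Delta> n"
      using large[of n] radius[of n] n \<epsilon> m by (intro mult_mono) auto
    then have "\<delta> \<le> \<sigma>1 * (crit n * \<Delta> n / (2 * vol))"
      unfolding \<delta>_def using \<sigma> vol_pos by (intro mult_left_mono divide_right_mono) auto
    also have "\<dots> \<le> obj n - obj (Suc n)" by (rule obj_decrease_accepted[OF \<open>accepted n\<close>])
    also have "\<dots> < \<delta>" using n by (intro N') auto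
    finally show False by simp
  qed
  then obtain n where "n \<ge> max N N'" "\<Delta> n < m"
    using not_eventually_rejected_bounded[OF _ m] by blast
  then show False using radius[of n] by simp
qed

text \<open>Comparison with the gradient at 0 bounds the gradients in L2 by
  \<open>L * vol + K\<close>, uniformly over the iterates; restriction to the symmetric difference
  contributes the factor \<open>sqrt d\<close>. The bound thus depends on the two iterates through
  \<open>d\<close> only.\<close>

lemma crit_diff:
  defines "K \<equiv> L2_norm M (G (\<lambda>_. 0))"
  assumes d: "d = measure M (sym_diff (U m) (U n))"
  shows "\<bar>crit m - crit n\<bar> \<le> 2 * (L * d * sqrt vol) + (L * vol + K) * sqrt d"
proof -
  let ?x = "indicator (U m) :: 'a \<Rightarrow> real" and ?y = "indicator (U n) :: 'a \<Rightarrow> real"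
  let ?S = "sym_diff (U m) (U n)"
  have S: "?S \<in> sets M" using U_sets[of m] U_sets[of n] by auto
  have xy: "?x \<in> L1 M" "?y \<in> L1 M" "(\<lambda>_. 0 :: real) \<in> L1 M"
    using indicator_L1[OF U_sets] by (auto simp: L1_def)
  note Gx = grad_Linf[OF xy(1)] and Gy = grad_Linf[OF xy(2)] and G0 = grad_Linf[OF xy(3)]
  have "L1_norm M (\<lambda>s. G ?x s - G ?y s) \<le> L2_norm M (\<lambda>s. G ?x s - G ?y s) * sqrt vol"
    unfolding vol_def by (intro L1_norm_le_L2_norm Linf_imp_L2 Linf_diff Gx Gy)
  also have "\<dots> \<le> (L * d) * sqrt vol"
    using L(2)[OF xy(1,2)] vol_pos L1_norm_diff_indicator[OF U_sets U_sets, of m n] d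
    by (intro mult_right_mono) auto
  finally have 1: "L1_norm M (\<lambda>s. G ?x s - G ?y s) \<le> L * d * sqrt vol" .
  have ind: "\<bar>z * (?x s - ?y s)\<bar> = \<bar>z * indicator ?S s\<bar>" for z s
    by (auto simp: indicator_def)
  have int: "integrable M (\<lambda>s. \<bar>G ?y s * indicator ?S s\<bar>)"
    "integrable M (\<lambda>s. \<bar>(G ?y s - G (\<lambda>_. 0) s) * indicator ?S s\<bar>)"
    "integrable M (\<lambda>s. \<bar>G (\<lambda>_. 0) s * indicator ?S s\<bar>)"
    using Linf_mult_L1[OF _ indicator_L1[OF S]] Linf_diff[OF Gy G0] Gy G0 by auto
  have "\<bar>LINT s|M. G ?y s * (?x s - ?y s)\<bar> \<le> (LINT s|M. \<bar>G ?y s * indicator ?S s\<bar>)"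
    unfolding ind[symmetric] by (rule integral_abs_bound)
  also have "\<dots> \<le> (LINT s|M. \<bar>(G ?y s - G (\<lambda>_. 0) s) * indicator ?S s\<bar> + \<bar>G (\<lambda>_. 0) s * indicator ?S s\<bar>)"
  proof (rule integral_mono)
    show "\<bar>G ?y s * indicator ?S s\<bar> \<le> \<bar>(G ?y s - G (\<lambda>_. 0) s) * indicator ?S s\<bar> + \<bar>G (\<lambda>_. 0) s * indicator ?S s\<bar>" for s
      by (cases "s \<in> ?S") auto
  qed (use int in auto)
  also have "\<dots> = L1_norm M (\<lambda>s. (G ?y s - G (\<lambda>_. 0) s) * indicator ?S s) + L1_norm M (\<lambda>s. G (\<lambda>_. 0) s * indicator ?S s)"
    using int by (simp add: L1_norm_def)
  also have "\<dots> \<le> L2_norm M (\<lambda>s. G ?y s - G (\<lambda>_. 0) s) * sqrt d + K * sqrt d"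
    unfolding K_def d
    by (intro add_mono L1_norm_indicator_le S Linf_imp_L2 Linf_diff Gy G0)
  also have "\<dots> \<le> (L * vol) * sqrt d + K * sqrt d"
  proof (intro add_right_mono mult_right_mono)
    have "L2_norm M (\<lambda>s. G ?y s - G (\<lambda>_. 0) s) \<le> L * L1_norm M (\<lambda>s. ?y s - 0)" by (rule L(2)[OF xy(2,3)])
    also have "L1_norm M (\<lambda>s. ?y s - 0) = measure M (U n)"
      using sets.sets_into_space[OF U_sets[of n]] by (simp add: L1_norm_def Int_absorb2)
    also have "L * measure M (U n) \<le> L * vol"
      unfolding vol_def using L(1) U_sets by (intro mult_left_mono finite_measure_mono sets.sets_into_space) auto
    finally show "L2_norm M (\<lambda>s. G ?y s - G (\<lambda>_. 0) s) \<le> L * vol" .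
  qed (simp add: d)
  finally have 2: "\<bar>LINT s|M. G ?y s * (?x s - ?y s)\<bar> \<le> (L * vol + K) * sqrt d" by (simp add: distrib_right)
  show ?thesis
    using criticality_diff[OF ind_feasible Gx ind_feasible Gy] 1 2 by (simp add: crit_def)
qed

text \<open>Let a late iterate have criticality at least \<open>2 * \<epsilon>\<close>. Up to the
  first later index with criticality below \<open>\<epsilon>\<close>, moving the set costs a
  proportional decrease of the objective, of which little remains. So these two iterates are close,
  and their criticalities differ by less than \<open>\<epsilon>\<close>.\<close>

lemma crit_tendsto_0: "crit \<longlonglongrightarrow> 0"
proof (rule LIMSEQ_I)
  fix r :: real assume r: "0 < r"
  define \<epsilon> where "\<epsilon> = r / 2"
  have \<epsilon>: "0 < \<epsilon>" using r by (simp add: \<epsilon>_def)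
  \<comment> \<open>The modulus of continuity of the criticality from \<open>crit_diff\<close>,
    which vanishes continuously at 0.\<close>
  define \<rho> where "\<rho> d = 2 * (L * d * sqrt vol) + (L * vol + L2_norm M (G (\<lambda>_. 0))) * sqrt d" for d
  have "isCont \<rho> 0" unfolding \<rho>_def by (intro continuous_intros)
  then have "(\<rho> \<longlongrightarrow> 0) (at 0)" by (simp add: isCont_def \<rho>_def)
  from LIM_D[OF this \<epsilon>] obtain \<eta> where \<eta>: "0 < \<eta>" "\<And>d. d \<noteq> 0 \<Longrightarrow> \<bar>d\<bar> < \<eta> \<Longrightarrow> \<bar>\<rho> d\<bar> < \<epsilon>"
    by auto
  have close: "\<bar>crit m - crit n\<bar> < \<epsilon>" if "measure M (sym_diff (U m) (U n)) < \<eta>" for m n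
  proof -
    let ?d = "measure M (sym_diff (U m) (U n))"
    have "\<bar>\<rho> ?d\<bar> < \<epsilon>"
    proof (cases "?d = 0")
      case True
      then show ?thesis using \<epsilon> by (simp add: \<rho>_def)
    next
      case False
      then show ?thesis using \<eta>(2)[of ?d] that by simp
    qed
    then show ?thesis using crit_diff[OF refl, of m n] unfolding \<rho>_def by linarith
  qed
  \<comment> \<open>Objective decrease per unit of measure moved while the criticality is at least
    \<open>\<epsilon>\<close>; the radius cancels, since a step moves at most
    \<open>\<Delta> k\<close>.\<close>
  define c where "c = \<sigma>1 * \<epsilon> / (2 * vol)"
  have c: "0 < c" using \<sigma> \<epsilon> vol_pos by (simp add: c_def)
  have move: "c * measure M (sym_diff (U k) (U (Suc k))) \<le> obj k - obj (Suc k)" if "\<epsilon> \<le> crit k" for k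
  proof (cases "accepted k")
    case True
    have "sym_diff (U k) (U (Suc k)) = D k" using accepted_step(1)[OF True] by auto
    then have "c * measure M (sym_diff (U k) (U (Suc k))) \<le> c * \<Delta> k"
      using c D_le[of k] by simp
    also have "\<dots> = \<sigma>1 * (\<epsilon> * \<Delta> k / (2 * vol))" by (simp add: c_def)
    also have "\<dots> \<le> \<sigma>1 * (crit k * \<Delta> k / (2 * vol))"
      using that \<sigma> vol_pos \<Delta>_bounds[of k] by (intro mult_left_mono divide_right_mono mult_right_mono) auto
    also have "\<dots> \<le> obj k - obj (Suc k)" by (rule obj_decrease_accepted[OF True])
    finally show ?thesis .
  next
    case False
    then show ?thesis by (simp add: obj_def rejected_step)
  qed
  obtain N where N: "\<And>m n. N \<le> m \<Longrightarrow> N \<le> n \<Longrightarrow> obj m - obj n < c * \<eta>"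
    using obj_small_decrease[of "c * \<eta>"] c \<eta>(1) by auto
  have "crit n < r" if n: "n \<ge> N" for n
  proof (rule ccontr)
    assume "\<not> crit n < r"
    then have big: "2 * \<epsilon> \<le> crit n" by (simp add: \<epsilon>_def)
    define l where "l = (LEAST l. n \<le> l \<and> crit l < \<epsilon>)"
    have "\<exists>l. n \<le> l \<and> crit l < \<epsilon>" using crit_frequently_small[OF \<epsilon>] by blast
    then have l: "n \<le> l" "crit l < \<epsilon>" unfolding l_def by (metis (mono_tags, lifting) LeastI_ex)+
    have before: "\<epsilon> \<le> crit k" if "n \<le> k" "k < l" for k
      using not_less_Least[of k "\<lambda>l. n \<le> l \<and> crit l < \<epsilon>"] that unfolding l_def by force
    have "k \<le> l \<longrightarrow> c * measure M (sym_diff (U n) (U k)) \<le> obj n - obj k" if "n \<le> k" for k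
      using that
    proof (induction k rule: dec_induct)
      case (step k)
      show ?case
      proof
        assume kl: "Suc k \<le> l"
        have "c * measure M (sym_diff (U n) (U (Suc k)))
            \<le> c * (measure M (sym_diff (U n) (U k)) + measure M (sym_diff (U k) (U (Suc k))))"
          using c by (intro mult_left_mono measure_sym_diff_triangle U_sets) auto
        also have "\<dots> \<le> (obj n - obj k) + (obj k - obj (Suc k))"
          using step kl move[OF before[of k]] by (simp add: distrib_left)
        finally show "c * measure M (sym_diff (U n) (U (Suc k))) \<le> obj n - obj (Suc k)" by simp
      qed
    qed simp
    then have "c * measure M (sym_diff (U n) (U l)) \<le> obj n - obj l" using l by blast
    also have "\<dots> < c * \<eta>" using n l by (intro N) auto
    finally have "measure M (sym_diff (U n) (U l)) < \<eta>" using c by simp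
    from close[OF this] show False using big l by linarith
  qed
  then show "\<exists>N. \<forall>n\<ge>N. norm (crit n - 0) < r" using crit_nonneg by (intro exI[of _ N]) auto
qed

end

end

section \<open>The two outcomes for Lebesgue measure on a bounded domain\<close>

theorem theorem4p4:
  fixes \<Omega> :: "'a::euclidean_space set"
    and J :: "('a \<Rightarrow> real) \<Rightarrow> real"
    and G :: "('a \<Rightarrow> real) \<Rightarrow> 'a \<Rightarrow> real"
    and \<Delta>max \<sigma>1 \<sigma>2 \<omega> :: real
    and U D :: "nat \<Rightarrow> 'a set"
    and \<Delta> :: "nat \<Rightarrow> real"
  assumes domain: "open \<Omega>" "connected \<Omega>" "\<Omega> \<noteq> {}" "bounded \<Omega>"
    and J: "well_defined_on_L1 (lborel_on \<Omega>) J"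
    and a: "bounded_below_on_L2 (lborel_on \<Omega>) J"
    and b: "L1_frechet_differentiable (lborel_on \<Omega>) J"
    and G: "represents_derivative (lborel_on \<Omega>) J G"
    and params: "0 < \<Delta>max" "\<Delta>max < measure lborel \<Omega>"
      "0 < \<sigma>1" "\<sigma>1 < \<sigma>2" "\<sigma>2 \<le> 1" "0 < \<omega>" "\<omega> < 1"
    and run: "BTR_run (lborel_on \<Omega>) J G \<Delta>max \<sigma>1 \<sigma>2 \<omega> U D \<Delta>"
  shows "decseq (\<lambda>n. J (indicator (U n))) \<and>
    ((\<exists>n0. \<forall>n\<ge>n0. measure lborel (sym_diff (U n0) (U n)) = 0) \<or>
     (\<forall>n0. \<exists>n1>n0. measure lborel (sym_diff (U n1) (U n0)) > 0)) \<and>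
    \<not> ((\<exists>n0. \<forall>n\<ge>n0. measure lborel (sym_diff (U n0) (U n)) = 0) \<and>
       (\<forall>n0. \<exists>n1>n0. measure lborel (sym_diff (U n1) (U n0)) > 0)) \<and>
    (\<forall>n0. (\<forall>n\<ge>n0. measure lborel (sym_diff (U n0) (U n)) = 0) \<longrightarrow>
       stationary (lborel_on \<Omega>) G (indicator (U n0))) \<and>
    ((\<forall>n0. \<exists>n1>n0. measure lborel (sym_diff (U n1) (U n0)) > 0) \<longrightarrow>
      (\<exists>f. weak_star_accumulation_point (lborel_on \<Omega>) (\<lambda>n. indicator (U n)) f) \<and>
      (\<forall>f. weak_star_accumulation_point (lborel_on \<Omega>) (\<lambda>n. indicator (U n)) f \<longrightarrow>
         f \<in> feasible (lborel_on \<Omega>)) \<and>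
      (lipschitz_L1_L2 (lborel_on \<Omega>) G \<longrightarrow>
         (\<lambda>n. criticality (lborel_on \<Omega>) G (indicator (U n))) \<longlonglongrightarrow> 0) \<and>
      (weak_norm_continuous_L2 (lborel_on \<Omega>) G \<longrightarrow>
         (\<forall>r::nat \<Rightarrow> nat. strict_mono r \<and>
            (\<lambda>k. criticality (lborel_on \<Omega>) G (indicator (U (r k)))) \<longlonglongrightarrow> 0 \<longrightarrow>
            (\<forall>f. weak_star_accumulation_point (lborel_on \<Omega>) (\<lambda>k. indicator (U (r k))) f \<longrightarrow>
               stationary (lborel_on \<Omega>) G f))))"
proof -
  let ?M = "lborel_on \<Omega>"
  have \<Omega>: "\<Omega> \<in> sets borel" using domain(1) by simp
  interpret finite_measure ?M by (rule finite_measure_lborel_on[OF domain(4) \<Omega>])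
  have "measure ?M (space ?M) = measure lborel \<Omega>"
    using \<Omega> by (simp add: space_restrict_space measure_restrict_space)
  then interpret btr ?M J G \<Delta>max \<sigma>1 \<sigma>2 \<omega> U D \<Delta>
    using divisible_lborel_on[OF domain(4) \<Omega>] a b G params run by unfold_locales auto
  have meas: "measure lborel (sym_diff (U m) (U n)) = measure ?M (sym_diff (U m) (U n))" for m n
  proof -
    have "U m \<subseteq> \<Omega>" "U n \<subseteq> \<Omega>"
      using U_sets[THEN sets.sets_into_space] by (auto simp: space_restrict_space)
    then show ?thesis using \<Omega> by (subst measure_restrict_space) auto
  qed
  \<comment> \<open>The ranges \<open>n1 > n0\<close> and \<open>n \<ge> n0\<close> differ by the
    index \<open>n0\<close> itself, where the symmetric difference is empty.\<close>
  have dichotomy: "(\<exists>n1>n0. measure lborel (sym_diff (U n1) (U n0)) > 0) \<longleftrightarrow>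
      \<not> (\<forall>n\<ge>n0. measure lborel (sym_diff (U n0) (U n)) = 0)" for n0
  proof -
    have "sym_diff (U n) (U n0) = sym_diff (U n0) (U n)" for n by blast
    then have "(\<exists>n1>n0. measure lborel (sym_diff (U n1) (U n0)) > 0) \<longleftrightarrow>
        (\<exists>n1>n0. measure lborel (sym_diff (U n0) (U n1)) \<noteq> 0)"
      by (simp add: zero_less_measure_iff)
    moreover have "measure lborel (sym_diff (U n0) (U n0)) = 0" by simp
    ultimately show ?thesis by (metis order_le_less)
  qed
  have stat: "stationary ?M G (indicator (U n0))"
    if "\<forall>n\<ge>n0. measure lborel (sym_diff (U n0) (U n)) = 0" for n0
    using eventually_constant_critical[of n0] that ind_feasible
    by (auto simp: stationary_def crit_def meas)
  have lip: "(\<lambda>n. criticality ?M G (indicator (U n))) \<longlonglongrightarrow> 0" if lips: "lipschitz_L1_L2 ?M G"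
  proof -
    obtain L where L: "\<And>x y. x \<in> L1 ?M \<Longrightarrow> y \<in> L1 ?M \<Longrightarrow>
        L2_norm ?M (\<lambda>s. G x s - G y s) \<le> L * L1_norm ?M (\<lambda>s. x s - y s)"
      using lips by (auto simp: lipschitz_L1_L2_def)
    \<comment> \<open>The given constant may be negative, so it is replaced by a nonnegative
      one.\<close>
    have "L2_norm ?M (\<lambda>s. G x s - G y s) \<le> max L 0 * L1_norm ?M (\<lambda>s. x s - y s)"
      if "x \<in> L1 ?M" "y \<in> L1 ?M" for x y
    proof -
      have "L * L1_norm ?M (\<lambda>s. x s - y s) \<le> max L 0 * L1_norm ?M (\<lambda>s. x s - y s)"
        by (intro mult_right_mono) (auto simp: L1_norm_def)
      then show ?thesis using L[OF that] by linarith
    qed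
    then show ?thesis using crit_tendsto_0[of "max L 0"] by (simp add: crit_def[abs_def])
  qed
  have wn: "stationary ?M G f"
    if "weak_norm_continuous_L2 ?M G" and C: "(\<lambda>k. criticality ?M G (indicator (U (r k)))) \<longlonglongrightarrow> 0"
      and acc: "weak_star_accumulation_point ?M (\<lambda>k. indicator (U (r k))) f" for r :: "nat \<Rightarrow> nat" and f
  proof -
    have f: "f \<in> feasible ?M" by (rule weak_star_accumulation_point_feasible[OF ind_feasible acc])
    obtain q :: "nat \<Rightarrow> nat" where q: "strict_mono q" "L2_weakly_converges ?M (\<lambda>k. indicator (U (r (q k)))) f"
      using weak_star_accumulation_point_imp_subsequence[OF ind_feasible acc] by blast
    have "(\<lambda>k. criticality ?M G (indicator (U (r (q k))))) \<longlonglongrightarrow> criticality ?M G f"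
      by (rule criticality_weakly_continuous[OF grad_Linf that(1) ind_feasible f q(2)])
    moreover have "(\<lambda>k. criticality ?M G (indicator (U (r (q k))))) \<longlonglongrightarrow> 0"
      using LIMSEQ_subseq_LIMSEQ[OF C q(1)] by (simp add: o_def)
    ultimately have "criticality ?M G f = 0" by (rule LIMSEQ_unique)
    with f show ?thesis by (simp add: stationary_def)
  qed
  have "decseq (\<lambda>n. J (indicator (U n)))" using decseq_obj by (simp add: obj_def[abs_def])
  then show ?thesis
    unfolding dichotomy
    using stat lip wn weak_star_accumulation_point_exists[OF ind_feasible]
      weak_star_accumulation_point_feasible[OF ind_feasible]
    by (intro conjI allI impI) (blast | simp)+
qed

end
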